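(* Let $n$ be a positive integer and let $\lambda_1,\lambda_2\in[0,n]$ be two numbers such that $\lambda_1\leq\lambda_2$. Then there exists an entire function $A$ of order $\rho(A)=n$ such that, for two normalized solutions $f_1$ and $f_2$ of the differential equation $f''+Af=0$, the associated Bank--Laine function $E=f_1f_2$ satisfies $\lambda(f_1)=\lambda_1$, $\lambda(f_2)=\lambda_2$ and $\lambda(E)=\lambda_2\leq\rho(E)=n$.
   Context: For an entire function $A$, all solutions of $f''+Af=0$ on $\mathbb{C}$ are entire. Two linearly independent solutions $f_1,f_2$ of $f''+Af=0$ are called normalized if their Wronskian satisfies $f_1f_2'-f_1'f_2=1$. An entire function $E$ is a Bank--Laine function if $E(z)=0$ implies $E'(z)=1$ or $E'(z)=-1$; the product $E=f_1f_2$ of two normalized solutions is a Bank--Laine function. For an entire function $f$, $\rho(f)=\limsup_{r\to\infty}\frac{\log^+ T(r,f)}{\log r}$ is the order ($T(r,f)$ being the Nevanlinna characteristic), and $\lambda(f)=\limsup_{r\to\infty}\frac{\log^+ n(r,0,f)}{\log r}$ is the exponent of convergence of the zeros, where $n(r,0,f)$ is the number of zeros of $f$ in $|z|\le r$, counted with multiplicity. *)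

theory Defs
  imports "HOL-Complex_Analysis.Complex_Analysis"
begin

abbreviation entire :: "(complex \<Rightarrow> complex) \<Rightarrow> bool" where
  "entire f \<equiv> f holomorphic_on UNIV"

(* The argument max 1 x gives log_plus 0 = 0 regardless of the value of ln outside x > 0. *)
definition log_plus :: "real \<Rightarrow> real" where
  "log_plus x = ln (max 1 x)"

(* n(r,0,f).  The sum ranges over a finite set whenever f is entire and not identically 0. *)
definition zero_count :: "real \<Rightarrow> (complex \<Rightarrow> complex) \<Rightarrow> nat" where
  "zero_count r f = (\<Sum>z\<in>{z. cmod z \<le> r \<and> f z = 0}. nat (zorder f z))"

(* n(r,f): poles in the closed disc, counted with multiplicity; zorder is negative at a pole. *)
definition pole_count :: "real \<Rightarrow> (complex \<Rightarrow> complex) \<Rightarrow> nat" where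
  "pole_count r f = (\<Sum>z\<in>{z. cmod z \<le> r \<and> is_pole f z}. nat (- zorder f z))"

(* m(r,f) *)
definition nevanlinna_proximity :: "real \<Rightarrow> (complex \<Rightarrow> complex) \<Rightarrow> real" where
  "nevanlinna_proximity r f =
     1 / (2 * pi) * integral {0..2 * pi} (\<lambda>t. log_plus (cmod (f (of_real r * cis t))))"

(* N(r,f) *)
definition nevanlinna_counting :: "real \<Rightarrow> (complex \<Rightarrow> complex) \<Rightarrow> real" where
  "nevanlinna_counting r f =
     integral {0..r} (\<lambda>t. (real (pole_count t f) - real (pole_count 0 f)) / t)
     + real (pole_count 0 f) * ln r"

(* T(r,f) = m(r,f) + N(r,f) *)
definition nevanlinna_characteristic :: "real \<Rightarrow> (complex \<Rightarrow> complex) \<Rightarrow> real" where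
  "nevanlinna_characteristic r f = nevanlinna_proximity r f + nevanlinna_counting r f"

lemma nevanlinna_characteristic_entire:
  assumes "entire f"
  shows "nevanlinna_characteristic r f = nevanlinna_proximity r f"
proof -
  have "\<not> is_pole f z" for z
    using assms not_is_pole_holomorphic[of UNIV z f] by auto
  then have "pole_count t f = 0" for t
    by (simp add: pole_count_def)
  then show ?thesis
    by (simp add: nevanlinna_characteristic_def nevanlinna_counting_def)
qed

(* Extended-real valued, since the upper limit may be infinite. *)
definition growth_order :: "(complex \<Rightarrow> complex) \<Rightarrow> ereal" where
  "growth_order f =
     Limsup at_top (\<lambda>r::real. ereal (log_plus (nevanlinna_characteristic r f) / ln r))"

definition exponent_of_convergence :: "(complex \<Rightarrow> complex) \<Rightarrow> ereal" where
  "exponent_of_convergence f =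
     Limsup at_top (\<lambda>r::real. ereal (log_plus (real (zero_count r f)) / ln r))"

definition is_solution :: "(complex \<Rightarrow> complex) \<Rightarrow> (complex \<Rightarrow> complex) \<Rightarrow> bool" where
  "is_solution A f \<longleftrightarrow> entire f \<and> (\<forall>z. deriv (deriv f) z + A z * f z = 0)"

definition lin_indep :: "(complex \<Rightarrow> complex) \<Rightarrow> (complex \<Rightarrow> complex) \<Rightarrow> bool" where
  "lin_indep f g \<longleftrightarrow> (\<forall>a b. (\<forall>z. a * f z + b * g z = 0) \<longrightarrow> a = 0 \<and> b = 0)"

definition normalized_solutions ::
  "(complex \<Rightarrow> complex) \<Rightarrow> (complex \<Rightarrow> complex) \<Rightarrow> (complex \<Rightarrow> complex) \<Rightarrow> bool" where
  "normalized_solutions A f\<^sub>1 f\<^sub>2 \<longleftrightarrow>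
     is_solution A f\<^sub>1 \<and> is_solution A f\<^sub>2 \<and> lin_indep f\<^sub>1 f\<^sub>2 \<and>
     (\<forall>z. f\<^sub>1 z * deriv f\<^sub>2 z - deriv f\<^sub>1 z * f\<^sub>2 z = 1)"

definition bank_laine :: "(complex \<Rightarrow> complex) \<Rightarrow> bool" where
  "bank_laine E \<longleftrightarrow>
     entire E \<and> (\<forall>z. E z = 0 \<longrightarrow> deriv E z = 1 \<or> deriv E z = -1)"

end

theory Submission
  imports Defs "HOL-Real_Asymp.Real_Asymp"
begin

text \<open>
  The Bank--Laine function is sought in the form \<open>E(z) = z Q(z\<^sup>n) exp(z\<^sup>n)\<close>, where
  \<open>Q(s) = \<Prod>j. (1 - s / \<zeta>\<^sub>j)\<close> has genus zero and its zeros \<open>\<zeta>\<^sub>j\<close> lie near the positive imaginary axis.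
  An entire function \<open>E = g\<^sub>1 g\<^sub>2\<close> with \<open>E' = - 1\<close> at the zeros of \<open>g\<^sub>1\<close> and \<open>E' = 1\<close> at those of \<open>g\<^sub>2\<close>
  is a product of normalized solutions \<open>f\<^sub>1 = g\<^sub>1 exp h\<close> and \<open>f\<^sub>2 = g\<^sub>2 exp(- h)\<close>
  (\<open>bank_laine_factorization\<close>): the Wronskian condition is a linear equation for \<open>h'\<close> whose
  solution has only removable singularities. So the exponents of convergence are prescribed by
  choosing how many \<open>\<zeta>\<^sub>j\<close> carry the sign \<open>- 1\<close> and how many carry the sign \<open>1\<close>.

  At a point with \<open>z\<^sup>n = \<zeta>\<^sub>k\<close> one finds \<open>E'(z) = - n exp(\<zeta>\<^sub>k) (\<Prod>j\<noteq>k. (1 - \<zeta>\<^sub>k / \<zeta>\<^sub>j))\<close>. Owing to the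
  factor \<open>z\<close> in \<open>E\<close> this does not depend on the choice of the \<open>n\<close>-th root. What remains
  is an infinite system of equations \<open>E' = \<plusminus> 1\<close> in which the zeros themselves are the unknowns. The
  factor \<open>exp(\<zeta>\<^sub>k)\<close> makes it solvable: after taking logarithms the equations read
  \<open>\<zeta>\<^sub>k = ln \<tau>\<^sub>k - (\<Sum>j\<noteq>k. ln (1 - \<zeta>\<^sub>k / \<zeta>\<^sub>j))\<close> up to multiples of \<open>2 \<pi> \<i>\<close>, with \<open>\<tau>\<^sub>k = \<plusminus> 1 / n\<close>, and for
  sufficiently sparse nodes \<open>Y\<^sub>k\<close> the right-hand side is a contraction near \<open>\<zeta>\<^sub>k = \<i> Y\<^sub>k\<close>
  (\<open>exists_zeros_with_prescribed_products\<close>). Nodes on a lattice with spacing of size \<open>ln\<^sup>2 m\<close> are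
  sparse enough, and still dense enough for every exponent up to the maximal one
  (\<open>exists_bank_laine_nodes\<close>).

  The counting function of these zeros is \<open>o(R / ln R)\<close>, so that \<open>ln |Q(s)| = o(|s|)\<close> away from the zeros.
  Hence \<open>E\<close> is as large as \<open>exp(c r\<^sup>n)\<close> on an arc where \<open>Re (z\<^sup>n) > 0\<close> and as small as
  \<open>exp(- c r\<^sup>n)\<close> on one where \<open>Re (z\<^sup>n) < 0\<close>. The identity \<open>4 A E\<^sup>2 = E'\<^sup>2 - 2 E E'' - 1\<close> turns the smallness
  of \<open>E\<close> into largeness of \<open>A\<close>, and both functions have order \<open>n\<close>.
\<close>

section \<open>Entire products of genus zero\<close>

text \<open>Indexing the product by the reciprocals \<open>p j\<close> of its zeros lets \<open>p j = 0\<close> stand for an absent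
  factor: a factor is deleted by the update \<open>p(k := 0)\<close>, and a product splits along any partition of
  the indices without re-enumerating the zeros.\<close>

definition genus_zero_product :: "(nat \<Rightarrow> complex) \<Rightarrow> complex \<Rightarrow> complex" where
  "genus_zero_product p z = (\<Prod>j. 1 - z * p j)"

context
  fixes p :: "nat \<Rightarrow> complex"
  assumes p: "summable (\<lambda>j. norm (p j))"
begin

lemma convergent_genus_zero_product: "convergent_prod (\<lambda>j. 1 - z * p j)"
proof -
  have "summable (\<lambda>j. norm ((1 - z * p j) - 1))"
    using summable_mult[OF p, of "norm z"] by (simp add: norm_mult)
  then show ?thesis
    by (intro abs_convergent_prod_imp_convergent_prod summable_imp_abs_convergent_prod)
qed

lemma genus_zero_product_LIMSEQ:
  "(\<lambda>N. \<Prod>j<N. 1 - z * p j) \<longlonglongrightarrow> genus_zero_product p z"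
  using convergent_prod_LIMSEQ[OF convergent_genus_zero_product[of z]]
  by (simp add: genus_zero_product_def LIMSEQ_lessThan_iff_atMost)

lemma genus_zero_product_entire: "genus_zero_product p holomorphic_on UNIV"
proof (rule holomorphic_uniform_sequence)
  fix z :: complex
  let ?P = "\<lambda>N x. \<Prod>j<N. 1 - x * p j"
  have "uniformly_convergent_on (cball z 1) ?P"
  proof (rule uniformly_convergent_on_prod')
    show "uniformly_convergent_on (cball z 1) (\<lambda>N x. \<Sum>j<N. norm (1 - x * p j - 1))"
    proof (rule Weierstrass_m_test')
      fix j x assume "x \<in> cball z 1"
      then have "norm x \<le> norm z + 1"
        using norm_triangle_sub[of x z] by (simp add: dist_norm norm_minus_commute)
      then show "norm (norm (1 - x * p j - 1)) \<le> (norm z + 1) * norm (p j)"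
        by (simp add: norm_mult mult_right_mono)
    qed (use p in \<open>auto intro: summable_mult\<close>)
  qed (auto intro!: continuous_intros)
  then obtain g where g: "uniform_limit (cball z 1) ?P g sequentially"
    by (auto simp: uniformly_convergent_on_def)
  have "g x = genus_zero_product p x" if "x \<in> cball z 1" for x
    using LIMSEQ_unique[OF tendsto_uniform_limitI[OF g that] genus_zero_product_LIMSEQ] .
  then have "uniform_limit (cball z 1) ?P (genus_zero_product p) sequentially"
    by (intro uniform_limit_cong'[THEN iffD1, OF _ _ g]) auto
  then show "\<exists>d>0. cball z d \<subseteq> UNIV \<and> uniform_limit (cball z d) ?P (genus_zero_product p) sequentially"
    by (intro exI[of _ 1]) auto
qed (auto intro!: holomorphic_intros)

lemma genus_zero_product_eq_0_iff:
  "genus_zero_product p z = 0 \<longleftrightarrow> (\<exists>j. z * p j = 1)"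
  using has_prod_eq_0_iff[OF convergent_prod_has_prod[OF convergent_genus_zero_product[of z]]]
  by (auto simp: genus_zero_product_def image_iff eq_commute[of "0::complex"] eq_commute[of "1::complex"])

lemma summable_norm_fun_upd_0: "summable (\<lambda>j. norm ((p(k := 0)) j))"
  by (rule summable_comparison_test[OF _ p]) auto

lemma genus_zero_product_at_0: "genus_zero_product p 0 = 1"
  by (simp add: genus_zero_product_def)

text \<open>Slow growth: finitely many factors grow polynomially, and the remaining ones
  contribute at most \<open>exp (\<epsilon> |z|)\<close>, where \<open>\<epsilon>\<close> is the tail of \<open>\<Sum>j. |p j|\<close>.\<close>

lemma norm_genus_zero_product_le:
  assumes "e > 0"
  shows "\<forall>\<^sub>F r in at_top. \<forall>z. norm z \<le> r \<longrightarrow> norm (genus_zero_product p z) \<le> exp (e * r)"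
proof -
  obtain J where J: "norm (\<Sum>j. norm (p (j + J))) < e / 2"
    using suminf_exist_split[OF _ p, of "e/2"] assms by auto
  define T where "T = (\<Sum>j. norm (p (j + J)))"
  have sJ: "summable (\<lambda>j. norm (p (j + J)))"
    using p by (subst summable_iff_shift)
  have T: "T < e / 2" "T \<ge> 0"
    using J suminf_nonneg[OF sJ] by (auto simp: T_def)
  define P where "P = (\<Sum>j. norm (p j))"
  have Pj: "norm (p j) \<le> P" for j
    using sum_le_suminf[OF p, of "{j}"] by (simp add: P_def)
  have P0: "P \<ge> 0" using Pj[of 0] by (meson norm_ge_zero order_trans)
  have "\<forall>\<^sub>F r in at_top. (1 + r * (P+1)) ^ J \<le> exp (e / 2 * r)"
  proof -
    have "\<forall>\<^sub>F r::real in at_top. (1 + r * (P+1)) powr J \<le> exp (e / 2 * r)"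
      using assms P0 by real_asymp
    then show ?thesis
      using eventually_gt_at_top[of 0]
    proof eventually_elim
      case (elim r)
      then show ?case using P0 by (subst (asm) powr_realpow) (auto intro!: add_pos_nonneg)
    qed
  qed
  then show ?thesis
    using eventually_gt_at_top[of 0]
  proof eventually_elim
    case (elim r)
    show ?case
    proof (intro allI impI)
      fix z :: complex assume z: "norm z \<le> r"
      have "norm (\<Prod>j<N. 1 - z * p j) \<le> exp (e * r)" if "N \<ge> J" for N
      proof -
        have f: "norm (1 - z * p j) \<le> 1 + r * norm (p j)" for j
          using norm_triangle_ineq4[of 1 "z * p j"] mult_right_mono[OF z, of "norm (p j)"]
          by (simp add: norm_mult)
        have "norm (\<Prod>j<N. 1 - z * p j) \<le> (\<Prod>j<N. 1 + r * norm (p j))"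
          unfolding prod_norm[symmetric] by (intro prod_mono) (use f in auto)
        also have "\<dots> = (\<Prod>j<J. 1 + r * norm (p j)) * (\<Prod>j\<in>{J..<N}. 1 + r * norm (p j))"
        proof -
          have "{..<N} = {..<J} \<union> {J..<N}" using that by auto
          show ?thesis unfolding \<open>{..<N} = {..<J} \<union> {J..<N}\<close> by (rule prod.union_disjoint) auto
        qed
        also have "\<dots> \<le> exp (e / 2 * r) * exp (e / 2 * r)"
        proof (rule mult_mono)
          have "(\<Prod>j<J. 1 + r * norm (p j)) \<le> (\<Prod>j<J. 1 + r * (P + 1))"
            using elim Pj by (intro prod_mono conjI add_left_mono mult_left_mono)
              (auto intro: add_nonneg_nonneg order_trans[OF Pj])
          also have "\<dots> = (1 + r * (P+1)) ^ J" by simp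
          finally show "(\<Prod>j<J. 1 + r * norm (p j)) \<le> exp (e / 2 * r)" using elim by linarith
          have "(\<Prod>j\<in>{J..<N}. 1 + r * norm (p j)) \<le> exp (\<Sum>j\<in>{J..<N}. r * norm (p j))"
            using elim by (intro prod_le_exp_sum) auto
          also have "(\<Sum>j\<in>{J..<N}. r * norm (p j)) = r * (\<Sum>j<N - J. norm (p (j + J)))"
            using that sum.shift_bounds_nat_ivl[of "\<lambda>j. norm (p j)" 0 J "N - J"]
            by (simp add: atLeast0LessThan flip: sum_distrib_left)
          also have "\<dots> \<le> r * T"
            using sum_le_suminf[OF sJ, of "{..<N-J}"] elim
            by (intro mult_left_mono) (auto simp: T_def)
          also have "r * T \<le> e / 2 * r" using T elim by simp
          finally show "(\<Prod>j\<in>{J..<N}. 1 + r * norm (p j)) \<le> exp (e / 2 * r)" by simp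
        qed (use elim in \<open>auto intro!: prod_nonneg\<close>)
        also have "\<dots> = exp (e * r)" by (simp flip: exp_add)
        finally show ?thesis .
      qed
      then show "norm (genus_zero_product p z) \<le> exp (e * r)"
        by (intro tendsto_upperbound[OF tendsto_norm[OF genus_zero_product_LIMSEQ]])
          (auto intro: eventually_sequentiallyI)
    qed
  qed
qed

end

text \<open>Under the disjointness hypothesis, in every factor \<open>(1 - z p\<^sub>j) (1 - z q\<^sub>j)\<close> the quadratic term vanishes.\<close>

lemma genus_zero_product_mult:
  assumes "summable (\<lambda>j. norm (p j))" "summable (\<lambda>j. norm (q j))"
    and "\<And>j. p j = 0 \<or> q j = 0"
  shows "genus_zero_product p z * genus_zero_product q z = genus_zero_product (\<lambda>j. p j + q j) z"
proof -
  have "(1 - z * p j) * (1 - z * q j) = 1 - z * (p j + q j)" for j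
    using assms(3)[of j] by auto
  then show ?thesis
    unfolding genus_zero_product_def
    by (subst prodinf_mult[OF convergent_genus_zero_product[OF assms(1)]
        convergent_genus_zero_product[OF assms(2)]]) simp
qed

lemma genus_zero_product_extract_factor:
  assumes "summable (\<lambda>j. norm (p j))"
  shows "genus_zero_product p z = (1 - z * p k) * genus_zero_product (p(k := 0)) z"
proof -
  let ?q = "\<lambda>j. if j = k then p k else 0"
  have q: "summable (\<lambda>j. norm (?q j))"
    by (rule summable_comparison_test[OF _ assms]) auto
  have "genus_zero_product ?q z = 1 - z * p k"
    unfolding genus_zero_product_def
    using has_prod_unique[OF has_prod_single[of k "\<lambda>j. 1 - z * p k"]]
    by (auto intro!: prodinf_cong simp: if_distrib cong: if_cong)
  moreover have "genus_zero_product ?q z * genus_zero_product (p(k := 0)) z = genus_zero_product p z"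
    by (subst genus_zero_product_mult[OF q summable_norm_fun_upd_0[OF assms]])
      (auto intro!: arg_cong[where f="\<lambda>p. genus_zero_product p z"])
  ultimately show ?thesis by simp
qed

section \<open>Adjusting the zeros of a product by a fixed point argument\<close>

lemma abs_ln_diff_le:
  assumes "x > (0::real)" "y > 0"
  shows "\<bar>ln x - ln y\<bar> \<le> \<bar>x - y\<bar> * (1 / x + 1 / y)"
proof -
  have "ln a - ln b \<le> \<bar>a - b\<bar> * (1 / b)" if "a > 0" "b > 0" for a b :: real
    using ln_diff_le[OF that] that by (simp add: field_simps)
  from this[of x y] this[of y x]
  have "ln x - ln y \<le> \<bar>x - y\<bar> * (1 / y)" "ln y - ln x \<le> \<bar>x - y\<bar> * (1 / x)"
    using assms by (simp_all add: abs_minus_commute)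
  moreover have "\<bar>x - y\<bar> * (1 / x) \<ge> 0" "\<bar>x - y\<bar> * (1 / y) \<ge> 0"
    using assms by simp_all
  ultimately show ?thesis
    unfolding distrib_left abs_le_iff by linarith
qed

lemma cmod_of_real_diff: "cmod (complex_of_real a - complex_of_real b) = \<bar>a - b\<bar>"
  by (metis norm_of_real of_real_diff)

lemma norm_Ln_diff_le:
  assumes "norm (a - 1) \<le> 1/4" "norm (b - 1) \<le> 1/4"
  shows "norm (Ln a - Ln b) \<le> 2 * norm (a - b)"
proof (rule field_differentiable_bound[of "cball 1 (1/4)" Ln "\<lambda>z. inverse z"])
  fix z :: complex assume z: "z \<in> cball 1 (1/4)"
  then have n: "norm (1 - z) \<le> 1/4" by (simp add: dist_norm)
  have "\<bar>Re (1 - z)\<bar> \<le> 1/4" using n abs_Re_le_cmod[of "1 - z"] by linarith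
  then have "Re z > 0" unfolding minus_complex.sel one_complex.sel by linarith
  then have "z \<notin> \<real>\<^sub>\<le>\<^sub>0" by (auto simp: complex_nonpos_Reals_iff)
  then show "(Ln has_field_derivative inverse z) (at z within cball 1 (1/4))"
    by (auto intro!: derivative_eq_intros)
  have "norm z \<ge> 1/2" using n norm_triangle_ineq2[of 1 "1 - z"] by simp
  then show "norm (inverse z) \<le> 2"
    using le_imp_inverse_le[of "1/2" "norm z"] by (simp add: norm_inverse)
qed (use assms in \<open>auto simp: dist_norm norm_minus_commute\<close>)

text \<open>The uniform bound on \<open>\<Sum>j. 1 / |Y j - Y k|\<close> is what makes the interaction of the zeros a
  small perturbation. The term \<open>j = k\<close> contributes \<open>1 / 0 = 0\<close>. The value \<open>1 / 10000\<close> is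
  small enough for all the estimates below.\<close>

locale sparse_nodes =
  fixes Y :: "nat \<Rightarrow> real"
  assumes Y_pos: "\<And>k. Y k > 0"
    and inj_Y: "inj Y"
    and summable_gaps: "\<And>k. summable (\<lambda>j. 1 / \<bar>Y j - Y k\<bar>)"
    and sum_gaps_le: "\<And>k. (\<Sum>j. 1 / \<bar>Y j - Y k\<bar>) \<le> 1 / 10000"
    and summable_inverse_nodes: "summable (\<lambda>j. 1 / Y j)"
    and sum_inverse_nodes_le: "(\<Sum>j. 1 / Y j) \<le> 1 / 10000"
begin

lemma Y_eq_iff: "Y k = Y l \<longleftrightarrow> k = l"
  using inj_Y by (auto dest: injD)

lemma Y_ge: "Y k \<ge> 10000"
proof -
  have "1 / Y k \<le> 1 / 10000"
    using sum_le_suminf[OF summable_inverse_nodes, of "{k}"] sum_inverse_nodes_le Y_pos[THEN less_imp_le]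
    by auto
  then show ?thesis using Y_pos[of k] by (simp add: field_simps)
qed

lemma gap_ge: "k \<noteq> l \<Longrightarrow> \<bar>Y k - Y l\<bar> \<ge> 10000"
proof -
  assume "k \<noteq> l"
  have "1 / \<bar>Y k - Y l\<bar> \<le> 1 / 10000"
    using sum_le_suminf[OF summable_gaps[of l], of "{k}"] sum_gaps_le[of l] by simp
  then show ?thesis using \<open>k \<noteq> l\<close> Y_eq_iff[of k l] by (simp add: field_simps)
qed

text \<open>The candidates for the zeros are \<open>Y k * (\<i> + v k)\<close>. The displacements \<open>Y k * v k\<close> may be much
  larger than the gaps between neighbouring nodes, so a bound on \<open>v\<close> alone does not keep the
  differences of the zeros near those of the nodes. The Lipschitz condition does.\<close>

definition near_axis :: "(nat \<Rightarrow> complex) \<Rightarrow> bool" where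
  "near_axis v \<longleftrightarrow> (\<forall>k. norm (v k) \<le> 1/10) \<and>
     (\<forall>k l. norm (of_real (Y k) * v k - of_real (Y l) * v l) \<le> \<bar>Y k - Y l\<bar> / 10)"

text \<open>This is the quotient of \<open>1 - \<zeta>\<^sub>k / \<zeta>\<^sub>j\<close> by \<open>1 - Y\<^sub>k / Y\<^sub>j\<close> with \<open>\<zeta>\<^sub>k = Y\<^sub>k (\<i> + v\<^sub>k)\<close>, written so that it
  equals \<open>1\<close> for \<open>j = k\<close> because of the convention \<open>x / 0 = 0\<close>.\<close>

definition factor_ratio :: "(nat \<Rightarrow> complex) \<Rightarrow> nat \<Rightarrow> nat \<Rightarrow> complex" where
  "factor_ratio v k j = 1 + of_real (Y k / (Y j - Y k)) * ((v j - v k) / (\<i> + v j))"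

lemma norm_shift_ge: "norm w \<le> 1/10 \<Longrightarrow> norm (\<i> + w) \<ge> 9/10"
  using norm_diff_ineq[of \<i> w] by simp

lemma factor_ratio_self: "factor_ratio v k k = 1"
  by (simp add: factor_ratio_def)

lemma factor_ratio_eq:
  assumes "norm (v j) \<le> 1/10" "j \<noteq> k"
  shows "(1 - of_real (Y k / Y j)) * factor_ratio v k j =
         1 - of_real (Y k) * (\<i> + v k) / (of_real (Y j) * (\<i> + v j))"
proof -
  have nz: "\<i> + v j \<noteq> 0" using norm_shift_ge[OF assms(1)] by auto
  have Yj: "complex_of_real (Y j) \<noteq> 0" "complex_of_real (Y j) - complex_of_real (Y k) \<noteq> 0"
    using Y_pos[of j] assms(2) Y_eq_iff[of j k] by (auto simp: of_real_eq_iff simp flip: of_real_diff)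
  have *: "(1 - a / b) * (1 + a / (b - a) * (y / c)) = 1 - a * (c - y) / (b * c)"
    if "b \<noteq> 0" "b - a \<noteq> 0" "c \<noteq> 0" for a b c y :: complex
  proof -
    have "1 - a / b = (b - a) / b" using that by (simp add: field_simps)
    moreover have "(b - a) / b * (a / (b - a) * (y / c)) = a * y / (b * c)"
      using that by simp
    ultimately show ?thesis using that by (simp add: field_simps)
  qed
  show ?thesis
    using *[OF Yj nz, of "v j - v k"] unfolding factor_ratio_def by simp
qed

context
  fixes v
  assumes adm: "near_axis v"
begin

lemma v_le: "norm (v k) \<le> 1/10" and
  v_lip: "norm (of_real (Y k) * v k - of_real (Y l) * v l) \<le> \<bar>Y k - Y l\<bar> / 10"
  using adm by (auto simp: near_axis_def)

lemma shift_ge: "norm (\<i> + v j) \<ge> 9/10"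
  using norm_shift_ge v_le by blast

lemma shift_nz: "\<i> + v j \<noteq> 0"
  using shift_ge[of j] by auto

text \<open>This uniform bound keeps all ratios in the domain of the principal logarithm. It rests on
  \<open>Y\<^sub>k (v\<^sub>j - v\<^sub>k) = (Y\<^sub>j v\<^sub>j - Y\<^sub>k v\<^sub>k) - v\<^sub>j (Y\<^sub>j - Y\<^sub>k)\<close>, where the Lipschitz condition controls the first
  difference.\<close>

lemma factor_ratio_le_const: "norm (factor_ratio v k j - 1) \<le> 1/4"
proof (cases "j = k")
  case False
  then have d: "\<bar>Y j - Y k\<bar> > 0" using Y_eq_iff[of j k] by simp
  have "of_real (Y k) * (v j - v k) = (of_real (Y j) * v j - of_real (Y k) * v k) - v j * of_real (Y j - Y k)"
    by (simp add: algebra_simps)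
  then have "norm (of_real (Y k) * (v j - v k)) \<le> \<bar>Y j - Y k\<bar> / 10 + norm (v j) * \<bar>Y j - Y k\<bar>"
    using norm_triangle_ineq4[of "of_real (Y j) * v j - of_real (Y k) * v k" "v j * of_real (Y j - Y k)"]
      v_lip[of j k] by (simp add: norm_mult cmod_of_real_diff)
  also have "\<dots> \<le> \<bar>Y j - Y k\<bar> / 5"
    using mult_right_mono[OF v_le[of j], of "\<bar>Y j - Y k\<bar>"] by simp
  finally have n: "norm (of_real (Y k) * (v j - v k)) \<le> \<bar>Y j - Y k\<bar> / 5" .
  have "norm (factor_ratio v k j - 1) = norm (of_real (Y k) * (v j - v k)) / \<bar>Y j - Y k\<bar> / norm (\<i> + v j)"
    by (simp add: factor_ratio_def norm_mult norm_divide abs_divide cmod_of_real_diff)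
  also have "\<dots> \<le> (\<bar>Y j - Y k\<bar> / 5) / \<bar>Y j - Y k\<bar> / (9/10)"
    by (intro frac_le n shift_ge) (use d n in \<open>auto intro!: divide_right_mono\<close>)
  also have "\<dots> \<le> 1/4" using d by simp
  finally show ?thesis .
qed (simp add: factor_ratio_self)

lemma factor_ratio_nz: "factor_ratio v k j \<noteq> 0"
  using factor_ratio_le_const[of k j] by auto

text \<open>The decay of this bound in \<open>j\<close> makes the logarithms of the ratios summable.\<close>

lemma factor_ratio_le: "norm (factor_ratio v k j - 1) \<le> 1/4 * (Y k * (1 / \<bar>Y j - Y k\<bar>))"
proof -
  have "norm (v j - v k) \<le> 1/5"
    using norm_triangle_ineq4[of "v j" "v k"] v_le[of j] v_le[of k] by linarith
  then have "norm (v j - v k) / norm (\<i> + v j) \<le> (1/5) / (9/10)"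
    by (intro frac_le shift_ge) auto
  then have "Y k / \<bar>Y j - Y k\<bar> * (norm (v j - v k) / norm (\<i> + v j)) \<le> Y k / \<bar>Y j - Y k\<bar> * (1/4)"
    using Y_pos[of k] by (intro mult_left_mono) auto
  then show ?thesis
    using Y_pos[of k] by (simp add: factor_ratio_def norm_mult norm_divide abs_divide mult.commute cmod_of_real_diff)
qed

text \<open>For \<open>j\<close> different from \<open>k\<close> and \<open>l\<close> the difference is a divided difference of the displacements
  over the three nodes \<open>Y\<^sub>j\<close>, \<open>Y\<^sub>k\<close>, \<open>Y\<^sub>l\<close>, which gains the factor \<open>|Y\<^sub>k - Y\<^sub>l|\<close>. For \<open>j = k\<close> or \<open>j = l\<close> one of
  the two ratios is \<open>1\<close> and the uniform bound suffices.\<close>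

lemma factor_ratio_lipschitz:
  assumes "k \<noteq> l"
  shows "norm (factor_ratio v k j - factor_ratio v l j) \<le>
           1/4 * (\<bar>Y k - Y l\<bar> * (1 / \<bar>Y j - Y k\<bar> + 1 / \<bar>Y j - Y l\<bar>))"
proof -
  have kl: "\<bar>Y k - Y l\<bar> > 0" using assms Y_eq_iff[of k l] by simp
  consider "j = k" | "j = l" | "j \<noteq> k" "j \<noteq> l" by blast
  then show ?thesis
  proof cases
    case 1
    then show ?thesis
      using factor_ratio_le_const[of l k] kl by (simp add: factor_ratio_self norm_minus_commute)
  next
    case 2
    then show ?thesis
      using factor_ratio_le_const[of k l] kl by (simp add: factor_ratio_self abs_minus_commute)
  next
    case 3
    define a b c :: complex where "a = of_real (Y j)" and "b = of_real (Y k)" and "c = of_real (Y l)"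
    have nz: "a - b \<noteq> 0" "a - c \<noteq> 0" "\<i> + v j \<noteq> 0"
      using 3 Y_eq_iff shift_nz by (auto simp: a_def b_def c_def)
    have e: "factor_ratio v k j - factor_ratio v l j =
          ((a * v j - c * v l) * (b - c) + (c * v l - b * v k) * (a - c)) / ((a - b) * (a - c) * (\<i> + v j))"
      using nz unfolding factor_ratio_def a_def[symmetric] b_def[symmetric] c_def[symmetric] of_real_divide of_real_diff
      by (simp add: divide_simps) (simp add: algebra_simps)
    have "norm ((a * v j - c * v l) * (b - c) + (c * v l - b * v k) * (a - c))
        \<le> \<bar>Y j - Y l\<bar> / 10 * \<bar>Y k - Y l\<bar> + \<bar>Y l - Y k\<bar> / 10 * \<bar>Y j - Y l\<bar>"
      unfolding a_def b_def c_def
      by (rule order_trans[OF norm_triangle_ineq], unfold norm_mult, intro add_mono mult_mono v_lip)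
        (auto simp: cmod_of_real_diff)
    then have n: "norm ((a * v j - c * v l) * (b - c) + (c * v l - b * v k) * (a - c)) \<le> \<bar>Y j - Y l\<bar> * \<bar>Y k - Y l\<bar> / 5"
      by (simp add: abs_minus_commute)
    have p: "\<bar>Y j - Y k\<bar> > 0" "\<bar>Y j - Y l\<bar> > 0" using 3 Y_eq_iff by auto
    have "norm (factor_ratio v k j - factor_ratio v l j) \<le>
       (\<bar>Y j - Y l\<bar> * \<bar>Y k - Y l\<bar> / 5) / (\<bar>Y j - Y k\<bar> * \<bar>Y j - Y l\<bar> * (9/10))"
      unfolding e norm_divide norm_mult
      by (intro frac_le n mult_mono shift_ge) (use p n in \<open>auto simp: a_def b_def c_def cmod_of_real_diff\<close>)
    also have "\<dots> \<le> 1/4 * (\<bar>Y k - Y l\<bar> * (1 / \<bar>Y j - Y k\<bar>))"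
      using p kl by (simp add: field_simps)
    also have "\<dots> \<le> 1/4 * (\<bar>Y k - Y l\<bar> * (1 / \<bar>Y j - Y k\<bar> + 1 / \<bar>Y j - Y l\<bar>))"
      using p kl by (intro mult_left_mono) auto
    finally show ?thesis .
  qed
qed

lemma norm_Ln_factor_ratio_le:
  "norm (Ln (factor_ratio v k j)) \<le> 1/2 * (Y k * (1 / \<bar>Y j - Y k\<bar>))"
  using norm_Ln_diff_le[OF factor_ratio_le_const[of k j], of 1] factor_ratio_le[of k j] by simp

lemma summable_norm_Ln_factor_ratio: "summable (\<lambda>j. norm (Ln (factor_ratio v k j)))"
proof (rule summable_comparison_test')
  show "summable (\<lambda>j. 1/2 * (Y k * (1 / \<bar>Y j - Y k\<bar>)))"
    by (intro summable_mult summable_gaps)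
  show "norm (norm (Ln (factor_ratio v k j))) \<le> 1/2 * (Y k * (1 / \<bar>Y j - Y k\<bar>))" for j
    using norm_Ln_factor_ratio_le[of k j] by simp
qed

lemmas summable_Ln_factor_ratio = summable_norm_cancel[OF summable_norm_Ln_factor_ratio]

end

definition log_correction :: "(nat \<Rightarrow> complex) \<Rightarrow> nat \<Rightarrow> complex" where
  "log_correction v k = (\<Sum>j. Ln (factor_ratio v k j))"

lemma norm_log_correction_le:
  assumes "near_axis v"
  shows "norm (log_correction v k) \<le> Y k / 20000"
proof -
  have "norm (log_correction v k) \<le> (\<Sum>j. 1/2 * (Y k * (1 / \<bar>Y j - Y k\<bar>)))"
    unfolding log_correction_def
    by (rule norm_suminf_le[OF norm_Ln_factor_ratio_le[OF assms]]) (intro summable_mult summable_gaps)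
  also have "\<dots> = 1/2 * (Y k * (\<Sum>j. 1 / \<bar>Y j - Y k\<bar>))"
    by (simp only: suminf_mult summable_gaps summable_mult)
  also have "\<dots> \<le> 1/2 * (Y k * (1/10000))"
    using sum_gaps_le[of k] Y_pos[of k] by (intro mult_left_mono) auto
  finally show ?thesis by simp
qed

lemma log_correction_lipschitz:
  assumes "near_axis v" "k \<noteq> l"
  shows "norm (log_correction v k - log_correction v l) \<le> \<bar>Y k - Y l\<bar> / 10000"
proof -
  have "log_correction v k - log_correction v l = (\<Sum>j. Ln (factor_ratio v k j) - Ln (factor_ratio v l j))"
    unfolding log_correction_def by (intro suminf_diff summable_Ln_factor_ratio assms)
  also have "norm \<dots> \<le> (\<Sum>j. 1/2 * (\<bar>Y k - Y l\<bar> * (1 / \<bar>Y j - Y k\<bar> + 1 / \<bar>Y j - Y l\<bar>)))"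
  proof (rule norm_suminf_le)
    fix j
    show "norm (Ln (factor_ratio v k j) - Ln (factor_ratio v l j)) \<le>
       1/2 * (\<bar>Y k - Y l\<bar> * (1 / \<bar>Y j - Y k\<bar> + 1 / \<bar>Y j - Y l\<bar>))"
      using norm_Ln_diff_le[OF factor_ratio_le_const[OF assms(1), of k j] factor_ratio_le_const[OF assms(1), of l j]]
        factor_ratio_lipschitz[OF assms, of j] by linarith
  qed (intro summable_mult summable_add summable_gaps)
  also have "\<dots> = 1/2 * (\<bar>Y k - Y l\<bar> * ((\<Sum>j. 1 / \<bar>Y j - Y k\<bar>) + (\<Sum>j. 1 / \<bar>Y j - Y l\<bar>)))"
    by (simp only: suminf_mult summable_gaps summable_mult summable_add suminf_add)
  also have "\<dots> \<le> 1/2 * (\<bar>Y k - Y l\<bar> * (1/10000 + 1/10000))"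
    using sum_gaps_le[of k] sum_gaps_le[of l] by (intro mult_left_mono add_mono) auto
  finally show ?thesis by simp
qed

text \<open>The difference reduces to that of \<open>(\<i> + v\<^sub>k) / (\<i> + v\<^sub>j)\<close> for the two sequences, because
  \<open>(v\<^sub>j - v\<^sub>k) / (\<i> + v\<^sub>j) = 1 - (\<i> + v\<^sub>k) / (\<i> + v\<^sub>j)\<close>. Since \<open>D\<close> bounds the relative displacements \<open>v\<close> and not
  \<open>Y v\<close>, no factor \<open>Y\<^sub>j\<close> appears and the sum over \<open>j\<close> converges.\<close>

lemma factor_ratio_diff_le:
  assumes "near_axis v" "near_axis u" "\<And>k. norm (v k - u k) \<le> D"
  shows "norm (factor_ratio v k j - factor_ratio u k j) \<le> 3 * D * (Y k * (1 / \<bar>Y j - Y k\<bar>))"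
proof -
  have D: "D \<ge> 0" using assms(3)[of 0] norm_ge_zero order_trans by blast
  note nz = shift_nz[OF assms(1), of j] shift_nz[OF assms(2), of j]
  have up: "norm (\<i> + u m) \<le> 11/10" for m
    using norm_triangle_ineq[of \<i> "u m"] v_le[OF assms(2), of m] by simp
  have "(v j - v k) / (\<i> + v j) - (u j - u k) / (\<i> + u j) =
     ((\<i> + u k) * (v j - u j) - (v k - u k) * (\<i> + u j)) / ((\<i> + v j) * (\<i> + u j))"
    using nz by (simp add: divide_simps) (simp add: algebra_simps)
  also have "norm \<dots> \<le> (11/10 * D + D * (11/10)) / (9/10 * (9/10))"
    unfolding norm_divide
  proof (rule frac_le)
    show "norm ((\<i> + u k) * (v j - u j) - (v k - u k) * (\<i> + u j)) \<le> 11/10 * D + D * (11/10)"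
      by (rule order_trans[OF norm_triangle_ineq4], unfold norm_mult, intro add_mono mult_mono up assms(3))
        (simp_all add: D)
    show "9 / 10 * (9 / 10) \<le> norm ((\<i> + v j) * (\<i> + u j))"
      unfolding norm_mult by (intro mult_mono shift_ge assms) auto
  qed (use D in auto)
  also have "\<dots> \<le> 3 * D" using D by simp
  finally have b: "norm ((v j - v k) / (\<i> + v j) - (u j - u k) / (\<i> + u j)) \<le> 3 * D" .
  have "factor_ratio v k j - factor_ratio u k j =
      of_real (Y k / (Y j - Y k)) * ((v j - v k) / (\<i> + v j) - (u j - u k) / (\<i> + u j))"
    by (simp add: factor_ratio_def algebra_simps)
  then have "norm (factor_ratio v k j - factor_ratio u k j) = \<bar>Y k / (Y j - Y k)\<bar> *
       norm ((v j - v k) / (\<i> + v j) - (u j - u k) / (\<i> + u j))"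
    by (simp only: norm_mult norm_of_real)
  also have "\<bar>Y k / (Y j - Y k)\<bar> = Y k / \<bar>Y j - Y k\<bar>"
    using Y_pos[of k] by (simp add: abs_divide)
  also have "Y k / \<bar>Y j - Y k\<bar> * norm ((v j - v k) / (\<i> + v j) - (u j - u k) / (\<i> + u j))
      \<le> Y k / \<bar>Y j - Y k\<bar> * (3 * D)"
    using b Y_pos[of k] by (intro mult_left_mono) auto
  finally show ?thesis by (simp add: mult_ac)
qed

lemma log_correction_diff_le:
  assumes "near_axis v" "near_axis u" "\<And>k. norm (v k - u k) \<le> D"
  shows "norm (log_correction v k - log_correction u k) \<le> D * Y k / 2"
proof -
  have D: "D \<ge> 0" using assms(3)[of 0] norm_ge_zero order_trans by blast
  have "log_correction v k - log_correction u k = (\<Sum>j. Ln (factor_ratio v k j) - Ln (factor_ratio u k j))"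
    unfolding log_correction_def by (intro suminf_diff summable_Ln_factor_ratio assms)
  also have "norm \<dots> \<le> (\<Sum>j. 6 * D * (Y k * (1 / \<bar>Y j - Y k\<bar>)))"
  proof (rule norm_suminf_le)
    fix j
    show "norm (Ln (factor_ratio v k j) - Ln (factor_ratio u k j)) \<le> 6 * D * (Y k * (1 / \<bar>Y j - Y k\<bar>))"
      using norm_Ln_diff_le[OF factor_ratio_le_const[OF assms(1), of k j] factor_ratio_le_const[OF assms(2), of k j]]
        factor_ratio_diff_le[OF assms, of k j] by linarith
  qed (intro summable_mult summable_gaps)
  also have "\<dots> = 6 * D * (Y k * (\<Sum>j. 1 / \<bar>Y j - Y k\<bar>))"
    by (simp only: suminf_mult summable_gaps summable_mult)
  also have "\<dots> \<le> 6 * D * (Y k * (1/10000))"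
    using sum_gaps_le[of k] Y_pos[of k] D by (intro mult_left_mono) auto
  also have "\<dots> \<le> D * Y k / 2" using D Y_pos[of k] by simp
  finally show ?thesis .
qed

text \<open>The product that belongs to the unperturbed zeros \<open>\<i> Y\<^sub>j\<close>, evaluated at the \<open>k\<close>-th of them: the
  factors \<open>1 - \<i> Y\<^sub>k / (\<i> Y\<^sub>j)\<close> are real, and the one with \<open>j = k\<close> is left out.\<close>

definition base_product :: "nat \<Rightarrow> complex" where
  "base_product k = genus_zero_product ((\<lambda>j. 1 / complex_of_real (Y j))(k := 0)) (of_real (Y k))"

definition base_log :: "nat \<Rightarrow> nat \<Rightarrow> real" where
  "base_log k j = (if j = k then 0 else ln \<bar>Y j - Y k\<bar> - ln (Y j))"

lemma abs_base_log_le: "\<bar>base_log k j\<bar> \<le> Y k * (1 / \<bar>Y j - Y k\<bar> + 1 / Y j)"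
proof (cases "j = k")
  case False
  then have p: "\<bar>Y j - Y k\<bar> > 0" using Y_eq_iff by simp
  have "\<bar>base_log k j\<bar> \<le> \<bar>\<bar>Y j - Y k\<bar> - Y j\<bar> * (1 / \<bar>Y j - Y k\<bar> + 1 / Y j)"
    using False abs_ln_diff_le[OF p Y_pos[of j]] by (simp add: base_log_def)
  also have "\<dots> \<le> Y k * (1 / \<bar>Y j - Y k\<bar> + 1 / Y j)"
    using Y_pos[of k] Y_pos[of j] p by (intro mult_right_mono) auto
  finally show ?thesis .
qed (use Y_pos[of k] Y_pos[of j] in \<open>simp add: base_log_def\<close>)

lemma summable_base_log: "summable (base_log k)"
proof (rule summable_comparison_test')
  show "summable (\<lambda>j. Y k * (1 / \<bar>Y j - Y k\<bar> + 1 / Y j))"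
    by (intro summable_mult summable_add summable_gaps summable_inverse_nodes)
  show "norm (base_log k j) \<le> Y k * (1 / \<bar>Y j - Y k\<bar> + 1 / Y j)" for j
    using abs_base_log_le by simp
qed

lemma summable_inverse_Y: "summable (\<lambda>j. norm (1 / complex_of_real (Y j)))"
  using summable_inverse_nodes Y_pos by (simp add: norm_divide less_imp_le)

lemma norm_base_product: "norm (base_product k) = exp (\<Sum>j. base_log k j)"
proof (rule LIMSEQ_unique)
  let ?p = "(\<lambda>j. 1 / complex_of_real (Y j))(k := 0)"
  show "(\<lambda>N. norm (\<Prod>j<N. 1 - of_real (Y k) * ?p j)) \<longlonglongrightarrow> norm (base_product k)"
    unfolding base_product_def
    by (intro tendsto_norm genus_zero_product_LIMSEQ summable_norm_fun_upd_0 summable_inverse_Y)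
  have "norm (1 - of_real (Y k) * ?p j) = exp (base_log k j)" for j
  proof (cases "j = k")
    case False
    have "1 - of_real (Y k) * ?p j = complex_of_real ((Y j - Y k) / Y j)"
      using False Y_pos[of j] by (simp add: field_simps)
    then have "norm (1 - of_real (Y k) * ?p j) = \<bar>(Y j - Y k) / Y j\<bar>"
      by (simp only: norm_of_real)
    also have "\<dots> = \<bar>Y j - Y k\<bar> / Y j"
      using Y_pos[of j] by (simp add: abs_divide)
    also have "\<dots> = exp (ln \<bar>Y j - Y k\<bar> - ln (Y j))"
      using False Y_eq_iff[of j k] Y_pos[of j] by (simp add: exp_diff)
    finally show ?thesis using False by (simp add: base_log_def)
  qed (simp add: base_log_def)
  then have "norm (\<Prod>j<N. 1 - of_real (Y k) * ?p j) = exp (\<Sum>j<N. base_log k j)" for N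
    by (simp add: prod_norm[symmetric] exp_sum)
  moreover have "(\<lambda>N. exp (\<Sum>j<N. base_log k j)) \<longlonglongrightarrow> exp (\<Sum>j. base_log k j)"
    by (intro tendsto_intros summable_LIMSEQ summable_base_log)
  ultimately show "(\<lambda>N. norm (\<Prod>j<N. 1 - of_real (Y k) * ?p j)) \<longlonglongrightarrow> exp (\<Sum>j. base_log k j)"
    by simp
qed

lemma base_product_nz: "base_product k \<noteq> 0"
  using norm_base_product[of k] by force

lemma abs_sum_base_log_le: "\<bar>\<Sum>j. base_log k j\<bar> \<le> Y k / 5000"
proof -
  have "norm (\<Sum>j. base_log k j) \<le> (\<Sum>j. Y k * (1 / \<bar>Y j - Y k\<bar> + 1 / Y j))"
    by (rule norm_suminf_le) (simp only: real_norm_def abs_base_log_le,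
        intro summable_mult summable_add summable_gaps summable_inverse_nodes)
  also have "\<dots> = Y k * ((\<Sum>j. 1 / \<bar>Y j - Y k\<bar>) + (\<Sum>j. 1 / Y j))"
    by (simp only: suminf_mult summable_gaps summable_mult summable_add suminf_add summable_inverse_nodes)
  also have "\<dots> \<le> Y k * (1/10000 + 1/10000)"
    using sum_gaps_le[of k] sum_inverse_nodes_le Y_pos[of k] by (intro mult_left_mono add_mono) auto
  finally show ?thesis by simp
qed

text \<open>The terms \<open>j = l\<close> of the first sum and \<open>j = k\<close> of the second both contain \<open>ln |Y\<^sub>k - Y\<^sub>l|\<close>, which
  cancels, so that only \<open>ln Y\<^sub>k - ln Y\<^sub>l\<close> remains of them. The remaining terms are collected in \<open>f\<close>.\<close>

lemma sum_base_log_lipschitz: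
  assumes "k \<noteq> l"
  shows "\<bar>(\<Sum>j. base_log k j) - (\<Sum>j. base_log l j)\<bar> \<le> \<bar>Y k - Y l\<bar> / 2500"
proof -
  define f where "f j = (if j = k \<or> j = l then 0 else ln \<bar>Y j - Y k\<bar> - ln \<bar>Y j - Y l\<bar>)" for j
  have f_le: "\<bar>f j\<bar> \<le> \<bar>Y k - Y l\<bar> * (1 / \<bar>Y j - Y k\<bar> + 1 / \<bar>Y j - Y l\<bar>)" for j
  proof (cases "j = k \<or> j = l")
    case False
    then have p: "\<bar>Y j - Y k\<bar> > 0" "\<bar>Y j - Y l\<bar> > 0" using Y_eq_iff by auto
    have "\<bar>f j\<bar> \<le> \<bar>\<bar>Y j - Y k\<bar> - \<bar>Y j - Y l\<bar>\<bar> * (1 / \<bar>Y j - Y k\<bar> + 1 / \<bar>Y j - Y l\<bar>)"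
      using False abs_ln_diff_le[OF p] by (simp add: f_def)
    also have "\<dots> \<le> \<bar>Y k - Y l\<bar> * (1 / \<bar>Y j - Y k\<bar> + 1 / \<bar>Y j - Y l\<bar>)"
      using p by (intro mult_right_mono) auto
    finally show ?thesis .
  qed (auto simp: f_def)
  have sf: "summable f"
  proof (rule summable_comparison_test')
    show "summable (\<lambda>j. \<bar>Y k - Y l\<bar> * (1 / \<bar>Y j - Y k\<bar> + 1 / \<bar>Y j - Y l\<bar>))"
      by (intro summable_mult summable_add summable_gaps)
    show "norm (f j) \<le> \<bar>Y k - Y l\<bar> * (1 / \<bar>Y j - Y k\<bar> + 1 / \<bar>Y j - Y l\<bar>)" for j
      using f_le by simp
  qed
  have eq: "base_log k j - base_log l j = f j + (if j = k then - base_log l j else 0) + (if j = l then base_log k j else 0)" for j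
    using assms by (auto simp: f_def base_log_def)
  have bl: "- base_log l k + base_log k l = ln (Y k) - ln (Y l)"
    using assms by (simp add: base_log_def abs_minus_commute)
  have sums: "(\<lambda>j. base_log k j - base_log l j) sums (suminf f + - base_log l k + base_log k l)"
    unfolding eq
    by (intro sums_add summable_sums sf sums_single[of k "\<lambda>j. - base_log l j"] sums_single[of l "base_log k"])
  have "(\<Sum>j. base_log k j) - (\<Sum>j. base_log l j) = suminf f + (ln (Y k) - ln (Y l))"
    using sums_unique[OF sums] suminf_diff[OF summable_base_log[of k] summable_base_log[of l]] bl
    by linarith
  moreover have "\<bar>suminf f\<bar> \<le> \<bar>Y k - Y l\<bar> / 5000"
  proof -
    have "norm (suminf f) \<le> (\<Sum>j. \<bar>Y k - Y l\<bar> * (1 / \<bar>Y j - Y k\<bar> + 1 / \<bar>Y j - Y l\<bar>))"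
      by (rule norm_suminf_le) (simp only: real_norm_def f_le, intro summable_mult summable_add summable_gaps)
    also have "\<dots> = \<bar>Y k - Y l\<bar> * ((\<Sum>j. 1 / \<bar>Y j - Y k\<bar>) + (\<Sum>j. 1 / \<bar>Y j - Y l\<bar>))"
      by (simp only: suminf_mult summable_gaps summable_mult summable_add suminf_add)
    also have "\<dots> \<le> \<bar>Y k - Y l\<bar> * (1/10000 + 1/10000)"
      using sum_gaps_le[of k] sum_gaps_le[of l] by (intro mult_left_mono add_mono) auto
    finally show ?thesis by simp
  qed
  moreover have "\<bar>ln (Y k) - ln (Y l)\<bar> \<le> \<bar>Y k - Y l\<bar> / 5000"
  proof -
    have "1 / Y k + 1 / Y l \<le> 1/10000 + 1/10000"
      by (intro add_mono frac_le Y_ge) auto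
    then have "\<bar>Y k - Y l\<bar> * (1 / Y k + 1 / Y l) \<le> \<bar>Y k - Y l\<bar> * (1/10000 + 1/10000)"
      by (rule mult_left_mono) simp
    from order_trans[OF abs_ln_diff_le[OF Y_pos[of k] Y_pos[of l]] this] show ?thesis by simp
  qed
  ultimately show ?thesis by linarith
qed

text \<open>In terms of the displacements the equations read \<open>Y\<^sub>k v\<^sub>k = b\<^sub>k - log_correction v k\<close>, where \<open>b\<^sub>k\<close> is
  a logarithm of the quotient of \<open>\<tau>\<^sub>k\<close> by the unperturbed value. Both \<open>b\<close> and the correction are
  Lipschitz functions of the nodes with a small constant, so the right-hand side preserves the set
  \<open>near_axis\<close>, and in the supremum norm of \<open>v\<close> it is a contraction. All \<open>\<tau>\<^sub>k\<close> have the same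
  modulus so that \<open>ln T\<close> cancels in the differences \<open>b\<^sub>k - b\<^sub>l\<close>.\<close>

theorem exists_zeros_with_prescribed_products:
  assumes tau: "\<And>k. norm (\<tau> k) = T" "T > 0" and T: "\<And>k. \<bar>ln T\<bar> \<le> Y k / 100"
  obtains \<zeta> where "\<And>k. norm (\<zeta> k - \<i> * of_real (Y k)) \<le> Y k / 10"
    and "inj \<zeta>"
    and "\<And>k. exp (\<zeta> k) * genus_zero_product ((\<lambda>j. 1 / \<zeta> j)(k := 0)) (\<zeta> k) = \<tau> k"
proof -
  define b where "b k = Ln (\<tau> k / (exp (\<i> * of_real (Y k)) * base_product k))" for k
  have arg_nz: "\<tau> k / (exp (\<i> * of_real (Y k)) * base_product k) \<noteq> 0" for k
    using tau(1)[of k] tau(2) base_product_nz[of k] by auto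
  have exp_b: "exp (b k) = \<tau> k / (exp (\<i> * of_real (Y k)) * base_product k)" for k
    unfolding b_def using arg_nz[of k] by (rule exp_Ln)
  have Re_b: "Re (b k) = ln T - (\<Sum>j. base_log k j)" for k
    unfolding b_def using arg_nz[of k] tau
    by (simp add: norm_divide norm_mult norm_base_product ln_div)
  have Im_b: "\<bar>Im (b k)\<bar> \<le> 4" for k
    using mpi_less_Im_Ln[OF arg_nz[of k]] Im_Ln_le_pi[OF arg_nz[of k]] pi_less_4 unfolding b_def by linarith
  have b_le: "norm (b k) \<le> Y k / 50" for k
    using cmod_le[of "b k"] Re_b[of k] Im_b[of k] T[of k] abs_sum_base_log_le[of k] Y_ge[of k] by linarith
  have b_lip: "norm (b k - b l) \<le> \<bar>Y k - Y l\<bar> / 50" if "k \<noteq> l" for k l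
  proof -
    have "\<bar>Re (b k) - Re (b l)\<bar> \<le> \<bar>Y k - Y l\<bar> / 2500"
      using sum_base_log_lipschitz[OF that] by (simp add: Re_b abs_minus_commute)
    moreover have "\<bar>Im (b k) - Im (b l)\<bar> \<le> 8"
      using Im_b[of k] Im_b[of l] by linarith
    ultimately have "norm (b k - b l) \<le> \<bar>Y k - Y l\<bar> / 2500 + 8"
      using cmod_le[of "b k - b l"] by simp
    also have "\<dots> \<le> \<bar>Y k - Y l\<bar> / 50"
      using gap_ge[OF that] by simp
    finally show ?thesis .
  qed
  define F where "F v k = (b k - log_correction v k) / of_real (Y k)" for v k
  have YF: "of_real (Y k) * F v k = b k - log_correction v k" for v k
    using Y_pos[of k] by (simp add: F_def)
  have F_near: "near_axis (F v)" if "near_axis v" for v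
    unfolding near_axis_def
  proof (intro conjI allI)
    fix k
    have "norm (b k - log_correction v k) \<le> Y k / 10"
      using norm_triangle_ineq4[of "b k" "log_correction v k"] b_le[of k] norm_log_correction_le[OF that, of k] Y_pos[of k]
      by linarith
    then show "norm (F v k) \<le> 1/10"
      using Y_pos[of k] by (simp add: F_def norm_divide field_simps)
  next
    fix k l
    show "norm (of_real (Y k) * F v k - of_real (Y l) * F v l) \<le> \<bar>Y k - Y l\<bar> / 10"
    proof (cases "k = l")
      case False
      have "of_real (Y k) * F v k - of_real (Y l) * F v l = (b k - b l) - (log_correction v k - log_correction v l)"
        by (simp add: YF)
      then show ?thesis
        using norm_triangle_ineq4[of "b k - b l" "log_correction v k - log_correction v l"]
          b_lip[OF False] log_correction_lipschitz[OF that False] by simp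
    qed simp
  qed
  have F_contr: "norm (F v k - F u k) \<le> D / 2"
    if "near_axis v" "near_axis u" "\<And>k. norm (v k - u k) \<le> D" for v u k D
  proof -
    have "F v k - F u k = (log_correction u k - log_correction v k) / of_real (Y k)"
      by (simp add: F_def flip: diff_divide_distrib)
    then have "norm (F v k - F u k) = norm (log_correction v k - log_correction u k) / Y k"
      using Y_pos[of k] by (simp add: norm_divide norm_minus_commute)
    also have "\<dots> \<le> (D * Y k / 2) / Y k"
      using log_correction_diff_le[OF that, of k] Y_pos[of k] by (intro divide_right_mono) auto
    finally show ?thesis using Y_pos[of k] by simp
  qed
  define S :: "(nat \<Rightarrow>\<^sub>C complex) set" where "S = {v. near_axis (apply_bcontfun v)}"
  have bc: "v \<in> bcontfun" if "near_axis v" for v :: "nat \<Rightarrow> complex"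
    using that by (intro bcontfun_normI[of _ "1/10"]) (auto simp: near_axis_def)
  \<comment> \<open>Both defining conditions are inequalities between finitely many values, so they pass to limits.\<close>
  have "closed S"
    unfolding closed_sequential_limits
  proof safe
    fix x and v :: "nat \<Rightarrow>\<^sub>C complex"
    assume x: "\<forall>n. x n \<in> S" "x \<longlonglongrightarrow> v"
    have lim: "(\<lambda>n. apply_bcontfun (x n) k) \<longlonglongrightarrow> apply_bcontfun v k" for k
    proof (rule metric_LIMSEQ_I)
      fix r :: real assume "r > 0"
      then obtain N where "\<forall>n\<ge>N. dist (x n) v < r" using metric_LIMSEQ_D[OF x(2)] by blast
      then show "\<exists>N. \<forall>n\<ge>N. dist (apply_bcontfun (x n) k) (apply_bcontfun v k) < r"
        using dist_bounded order.strict_trans1 by blast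
    qed
    show "v \<in> S"
      unfolding S_def near_axis_def mem_Collect_eq
    proof (intro conjI allI)
      fix k l
      show "norm (v k) \<le> 1/10"
        by (rule tendsto_upperbound[OF tendsto_norm[OF lim[of k]]])
          (use x(1) in \<open>auto simp: S_def near_axis_def\<close>)
      show "norm (of_real (Y k) * v k - of_real (Y l) * v l) \<le> \<bar>Y k - Y l\<bar> / 10"
        by (rule tendsto_upperbound[OF tendsto_norm[OF tendsto_diff[OF
                tendsto_mult_left[OF lim[of k]] tendsto_mult_left[OF lim[of l]]]]])
          (use x(1) in \<open>auto simp: S_def near_axis_def\<close>)
    qed
  qed
  have "complete S"
    unfolding complete_def
  proof safe
    fix x assume x: "\<forall>n. x n \<in> S" "Cauchy x"
    then obtain g where "uniform_limit UNIV x g sequentially"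
      using uniformly_convergent_eq_cauchy[of "\<lambda>_. True" x]
      unfolding Cauchy_def uniform_limit_sequentially_iff
      by (metis dist_fun_lt_imp_dist_val_lt)
    from uniform_limit_bcontfunE[OF this sequentially_bot]
    obtain l where "x \<longlonglongrightarrow> l" by metis
    then show "\<exists>l\<in>S. x \<longlonglongrightarrow> l"
      using \<open>closed S\<close> x(1) unfolding closed_sequential_limits by blast
  qed
  moreover have "S \<noteq> {}"
  proof -
    have "near_axis (apply_bcontfun (0 :: nat \<Rightarrow>\<^sub>C complex))"
      by (simp add: near_axis_def)
    then show ?thesis unfolding S_def by blast
  qed
  ultimately have "\<exists>!v\<in>S. Bcontfun (F (apply_bcontfun v)) = v"
  proof (rule Banach_fix[where c="1/2"])
    show "(\<lambda>v. Bcontfun (F (apply_bcontfun v))) ` S \<subseteq> S"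
      using F_near bc by (auto simp: S_def Bcontfun_inverse)
    fix v u assume vu: "v \<in> S" "u \<in> S"
    show "dist (Bcontfun (F (apply_bcontfun v))) (Bcontfun (F (apply_bcontfun u))) \<le> 1/2 * dist v u"
    proof (rule dist_bound)
      fix k
      show "dist (apply_bcontfun (Bcontfun (F (apply_bcontfun v))) k)
              (apply_bcontfun (Bcontfun (F (apply_bcontfun u))) k) \<le> 1/2 * dist v u"
        using F_contr[of "apply_bcontfun v" "apply_bcontfun u" "dist v u" k] vu dist_bounded[of v _ u] F_near bc
        by (simp add: S_def Bcontfun_inverse dist_norm)
    qed
  qed auto
  then obtain w where w: "w \<in> S" "Bcontfun (F (apply_bcontfun w)) = w" by blast
  define v where "v = apply_bcontfun w"
  have v: "near_axis v" using w(1) by (simp add: S_def v_def)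
  have fixed: "F v = v"
    using w(2) F_near[OF v] bc Bcontfun_inverse unfolding v_def by metis
  define \<zeta> where "\<zeta> k = of_real (Y k) * (\<i> + v k)" for k
  have zeta_nz: "\<zeta> k \<noteq> 0" for k
    using Y_pos[of k] shift_nz[OF v, of k] by (simp add: \<zeta>_def)
  show thesis
  proof
    fix k
    have "\<zeta> k - \<i> * of_real (Y k) = of_real (Y k) * v k" by (simp add: \<zeta>_def algebra_simps)
    then show "norm (\<zeta> k - \<i> * of_real (Y k)) \<le> Y k / 10"
      using Y_pos[of k] v_le[OF v, of k] by (simp add: norm_mult)
  next
    show "inj \<zeta>"
    proof (rule injI, rule ccontr)
      fix k l assume e: "\<zeta> k = \<zeta> l" and "k \<noteq> l"
      have "of_real (Y k) * v k - of_real (Y l) * v l = - \<i> * of_real (Y k - Y l)"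
        using e by (simp add: \<zeta>_def algebra_simps)
      then have "norm (of_real (Y k) * v k - of_real (Y l) * v l) = \<bar>Y k - Y l\<bar>"
        by (simp only: norm_mult norm_minus_cancel norm_ii norm_of_real) simp
      then have "\<bar>Y k - Y l\<bar> \<le> \<bar>Y k - Y l\<bar> / 10"
        using v_lip[OF v, of k l] by simp
      then show False using gap_ge[OF \<open>k \<noteq> l\<close>] by simp
    qed
  next
    fix k
    let ?p = "(\<lambda>j. 1 / \<zeta> j)(k := 0)" and ?q = "(\<lambda>j. 1 / complex_of_real (Y j))(k := 0)"
    have fac: "1 - \<zeta> k * ?p j = (1 - of_real (Y k) * ?q j) * exp (Ln (factor_ratio v k j))" for j
    proof (cases "j = k")
      case False
      then show ?thesis
        using factor_ratio_eq[of v j k, OF v_le[OF v]] factor_ratio_nz[OF v, of k j]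
        by (simp add: \<zeta>_def)
    qed (simp add: factor_ratio_self)
    have "genus_zero_product ?p (\<zeta> k) = base_product k * exp (log_correction v k)"
      unfolding genus_zero_product_def fac base_product_def log_correction_def
      prodinf_exp[OF summable_Ln_factor_ratio[OF v, of k], symmetric]
      by (intro prodinf_mult[symmetric] convergent_genus_zero_product convergent_prod_exp
          summable_norm_fun_upd_0 summable_inverse_Y summable_Ln_factor_ratio[OF v])
    moreover have "exp (\<zeta> k) = exp (\<i> * of_real (Y k)) * exp (b k - log_correction v k)"
      using YF[of k v] unfolding fixed by (simp add: \<zeta>_def distrib_left exp_add mult.commute)
    ultimately show "exp (\<zeta> k) * genus_zero_product ?p (\<zeta> k) = \<tau> k"
      using base_product_nz[of k] by (simp add: exp_diff exp_b)
  qed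
qed

end

section \<open>Nodes of prescribed density\<close>

text \<open>The factor \<open>ln\<^sup>2\<close> makes \<open>\<Sum>m. 1 / lattice D m\<close> converge and the number of lattice points
  up to \<open>R\<close> of size \<open>o(R / ln R)\<close>, while it changes no exponent of convergence. A large \<open>D\<close> makes the sum small.\<close>

definition lattice :: "real \<Rightarrow> nat \<Rightarrow> real" where
  "lattice D m = D * real m * (ln (real m + 2))\<^sup>2"

lemma lattice_0 [simp]: "lattice D 0 = 0"
  by (simp add: lattice_def)

lemma ln_shift_ge_1: "m \<ge> 1 \<Longrightarrow> ln (real m + 2) \<ge> 1"
proof -
  assume m: "m \<ge> 1"
  have "exp 1 \<le> real m + 2" using exp_le m by linarith
  then show ?thesis using m by (subst ln_ge_iff) auto
qed

text \<open>Superadditivity bounds the gap between two lattice points by the lattice point of the index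
  difference, so that sums over gaps reduce to sums over the lattice.\<close>

lemma lattice_superadditive:
  assumes "D > 0" "k \<le> j"
  shows "lattice D (j - k) \<le> lattice D j - lattice D k"
proof -
  have *: "(ln (real i + 2))\<^sup>2 \<le> (ln (real j + 2))\<^sup>2" if "i \<le> j" for i
    using that by (intro power_mono) auto
  have "real (j - k) * (ln (real (j - k) + 2))\<^sup>2 + real k * (ln (real k + 2))\<^sup>2
      \<le> real (j - k) * (ln (real j + 2))\<^sup>2 + real k * (ln (real j + 2))\<^sup>2"
    by (intro add_mono mult_left_mono *) (use assms in auto)
  also have "\<dots> = real j * (ln (real j + 2))\<^sup>2"
    using assms by (simp add: of_nat_diff algebra_simps)
  finally show ?thesis
    using mult_left_mono[of _ _ D] assms(1) unfolding lattice_def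
    by (fastforce simp: algebra_simps)
qed

lemma lattice_ge: "D > 0 \<Longrightarrow> lattice D m \<ge> D * real m"
  by (cases "m = 0") (use ln_shift_ge_1[of m] in \<open>auto simp: lattice_def\<close>)

lemma lattice_strict_mono:
  assumes "D > 0" shows "strict_mono (lattice D)"
proof (rule strict_monoI)
  fix k j :: nat assume "k < j"
  then have "0 < D * real (j - k)" using assms by simp
  also have "\<dots> \<le> lattice D (j - k)" using lattice_ge assms by blast
  also have "\<dots> \<le> lattice D j - lattice D k" using lattice_superadditive assms \<open>k < j\<close> by simp
  finally show "lattice D k < lattice D j" by simp
qed

text \<open>The right-hand side is a discrete derivative of \<open>- 1 / ln x\<close>, whose derivative is \<open>1 / (x ln\<^sup>2 x)\<close>; the factor
  \<open>3\<close> absorbs the replacement of \<open>m + 2\<close> by \<open>m\<close>.\<close>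

lemma inverse_log_telescope:
  assumes "m \<ge> 1"
  shows "1 / (real m * (ln (real m + 2))\<^sup>2) \<le> 3 * (1 / ln (real m + 1) - 1 / ln (real m + 2))"
proof -
  define x where "x = real m + 2"
  have x: "x \<ge> 3" using assms by (simp add: x_def)
  have l: "ln (x - 1) > 0" "ln x > 0" using x by auto
  have "1 / x \<le> ln x - ln (x - 1)"
    using ln_diff_le[of "x - 1" x] x by (simp add: field_simps)
  then have "(1 / x) / (ln x * ln x) \<le> (ln x - ln (x - 1)) / (ln (x - 1) * ln x)"
    using l x by (intro frac_le mult_right_mono) auto
  also have "\<dots> = 1 / ln (x - 1) - 1 / ln x"
    using l by (simp add: field_simps)
  finally have 1: "1 / (x * (ln x)\<^sup>2) \<le> 1 / ln (x - 1) - 1 / ln x"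
    by (simp add: power2_eq_square)
  have "1 / real m \<le> 3 / x" using assms by (simp add: x_def field_simps)
  then have "1 / real m * (1 / (ln x)\<^sup>2) \<le> 3 / x * (1 / (ln x)\<^sup>2)"
    by (intro mult_right_mono) auto
  then have "1 / (real m * (ln x)\<^sup>2) \<le> 3 * (1 / (x * (ln x)\<^sup>2))" by simp
  also have "\<dots> \<le> 3 * (1 / ln (x - 1) - 1 / ln x)" using 1 by simp
  also have "x - 1 = real m + 1" by (simp add: x_def)
  finally show ?thesis by (simp only: x_def)
qed

lemma sum_inverse_lattice_le:
  assumes "D > 0" "finite F"
  shows "(\<Sum>m\<in>F. 1 / lattice D m) \<le> 5 / D"
proof -
  have nn: "1 / lattice D m \<ge> 0" for m
    using assms(1) by (simp add: lattice_def)
  obtain N where N: "F \<subseteq> {..N}" using assms(2) finite_nat_set_iff_bounded_le by auto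
  have partial: "(\<Sum>m\<le>N. 1 / lattice 1 m) \<le> 3 * (1 / ln 2 - 1 / ln (real N + 2))" for N
  proof (induction N)
    case (Suc N)
    then show ?case
      using inverse_log_telescope[of "Suc N"] by (simp add: lattice_def add_ac)
  qed (simp add: lattice_def)
  have "(\<Sum>m\<in>F. 1 / lattice D m) \<le> (\<Sum>m\<le>N. 1 / lattice D m)"
    using N nn by (intro sum_mono2) auto
  also have "\<dots> = (\<Sum>m\<le>N. 1 / lattice 1 m) / D"
    unfolding sum_divide_distrib by (simp add: lattice_def mult_ac)
  also have "(\<Sum>m\<le>N. 1 / lattice 1 m) \<le> 5"
  proof -
    have "3 * (1 / ln 2 - 1 / ln (real N + 2)) \<le> 3 * (1 / ln 2)" by simp
    also have "\<dots> \<le> 5" using ln2_ge_two_thirds by (simp add: field_simps)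
    finally show ?thesis using partial[of N] by linarith
  qed
  finally show ?thesis using assms(1) by (simp add: divide_right_mono)
qed

lemma sum_inverse_lattice_gaps_le:
  assumes "D > 0" "finite F"
  shows "(\<Sum>m\<in>F. 1 / \<bar>lattice D m - lattice D p\<bar>) \<le> 10 / D"
proof -
  let ?g = "\<lambda>m. 1 / \<bar>lattice D m - lattice D p\<bar>"
  have pos: "lattice D i > 0" if "i > 0" for i
    using strict_monoD[OF lattice_strict_mono[OF assms(1)] that] by simp
  have A: "?g m \<le> 1 / lattice D (p - m)" if "m \<le> p" for m
  proof (cases "m = p")
    case False
    then show ?thesis
      using lattice_superadditive[OF assms(1) that] pos[of "p - m"] that by (intro frac_le) auto
  qed simp
  have B: "?g m \<le> 1 / lattice D (m - p)" if "p < m" for m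
    using lattice_superadditive[OF assms(1), of p m] pos[of "m - p"] that by (intro frac_le) auto
  have "sum ?g F = sum ?g (F \<inter> {..p}) + sum ?g (F \<inter> {p<..})"
    using assms(2) by (subst sum.union_disjoint[symmetric]) (auto intro!: sum.cong)
  also have "sum ?g (F \<inter> {..p}) \<le> (\<Sum>m\<in>F \<inter> {..p}. 1 / lattice D (p - m))"
    by (intro sum_mono A) auto
  also have "\<dots> = (\<Sum>i\<in>(\<lambda>m. p - m) ` (F \<inter> {..p}). 1 / lattice D i)"
    by (subst sum.reindex) (auto intro!: inj_onI)
  also have "\<dots> \<le> 5 / D" using assms by (intro sum_inverse_lattice_le) auto
  also have "sum ?g (F \<inter> {p<..}) \<le> (\<Sum>m\<in>F \<inter> {p<..}. 1 / lattice D (m - p))"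
    by (intro sum_mono B) auto
  also have "\<dots> = (\<Sum>i\<in>(\<lambda>m. m - p) ` (F \<inter> {p<..}). 1 / lattice D i)"
    by (subst sum.reindex) (auto intro!: inj_onI)
  also have "\<dots> \<le> 5 / D" using assms by (intro sum_inverse_lattice_le) auto
  finally show ?thesis by simp
qed

lemma sparse_nodes_lattice:
  assumes D: "D \<ge> 100000" and t: "inj t" "\<And>j. t j \<ge> 1"
  shows "sparse_nodes (\<lambda>j. lattice D (t j))"
proof -
  have D0: "D > 0" using D by simp
  have 10: "10 / D \<le> 1 / 10000" "5 / D \<le> 1 / 10000" using D by (auto simp: field_simps)
  have pos: "lattice D (t j) > 0" for j
    using strict_monoD[OF lattice_strict_mono[OF D0], of 0 "t j"] t(2)[of j] by simp
  have gap: "(\<Sum>j<N. 1 / \<bar>lattice D (t j) - lattice D (t k)\<bar>) \<le> 1 / 10000" for N k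
  proof -
    have "(\<Sum>j<N. 1 / \<bar>lattice D (t j) - lattice D (t k)\<bar>) =
        (\<Sum>m\<in>t ` {..<N}. 1 / \<bar>lattice D m - lattice D (t k)\<bar>)"
      using t(1) by (subst sum.reindex) (auto intro: inj_on_subset)
    also have "\<dots> \<le> 10 / D" using D0 by (intro sum_inverse_lattice_gaps_le) auto
    finally show ?thesis using 10 by linarith
  qed
  have inv: "(\<Sum>j<N. 1 / lattice D (t j)) \<le> 1 / 10000" for N
  proof -
    have "(\<Sum>j<N. 1 / lattice D (t j)) = (\<Sum>m\<in>t ` {..<N}. 1 / lattice D m)"
      using t(1) by (subst sum.reindex) (auto intro: inj_on_subset)
    also have "\<dots> \<le> 5 / D" using D0 by (intro sum_inverse_lattice_le) auto
    finally show ?thesis using 10 by linarith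
  qed
  show ?thesis
  proof
    show "inj (\<lambda>j. lattice D (t j))"
      using t(1) strict_mono_eq[OF lattice_strict_mono[OF D0]] by (auto simp: inj_def)
    show s: "summable (\<lambda>j. 1 / \<bar>lattice D (t j) - lattice D (t k)\<bar>)" for k
      by (rule summableI_nonneg_bounded[OF _ gap]) auto
    show "(\<Sum>j. 1 / \<bar>lattice D (t j) - lattice D (t k)\<bar>) \<le> 1 / 10000" for k
      by (rule suminf_le_const[OF s gap])
    show s: "summable (\<lambda>j. 1 / lattice D (t j))"
      by (rule summableI_nonneg_bounded[OF _ inv]) (use pos in \<open>auto intro: less_imp_le\<close>)
    show "(\<Sum>j. 1 / lattice D (t j)) \<le> 1 / 10000"
      by (rule suminf_le_const[OF s inv])
  qed (rule pos)
qed

text \<open>The logarithm makes the function unbounded, and hence the set defined from it infinite, also for \<open>\<mu> = 0\<close>.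
  Halving makes all increments at integers at most \<open>1\<close>.\<close>

definition density_fun :: "real \<Rightarrow> real \<Rightarrow> real" where
  "density_fun \<mu> x = (x powr \<mu> + ln (1 + x)) / 2"

text \<open>These are the integers at which the integer part of \<open>density_fun \<mu>\<close> jumps. As it jumps by one, the set has
  \<open>\<lfloor>density_fun \<mu> N\<rfloor>\<close> elements up to \<open>N\<close>.\<close>

definition density_set :: "real \<Rightarrow> nat set" where
  "density_set \<mu> = {m. m \<ge> 1 \<and> \<lfloor>density_fun \<mu> (real m - 1)\<rfloor> < \<lfloor>density_fun \<mu> (real m)\<rfloor>}"

context
  fixes \<mu> :: real
  assumes mu: "0 \<le> \<mu>" "\<mu> \<le> 1"
begin

lemma density_fun_mono: "0 \<le> x \<Longrightarrow> x \<le> y \<Longrightarrow> density_fun \<mu> x \<le> density_fun \<mu> y"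
  unfolding density_fun_def using mu by (intro divide_right_mono add_mono powr_mono2) auto

lemma density_fun_increment: "density_fun \<mu> (real (Suc m)) \<le> density_fun \<mu> (real m) + 1"
proof -
  have 1: "real (Suc m) powr \<mu> \<le> real m powr \<mu> + 1"
  proof (cases "m = 0")
    case False
    define x where "x = real m"
    have x: "x > 0" using False by (simp add: x_def)
    have e: "y powr \<mu> = y * y powr (\<mu> - 1)" if "y > 0" for y
      using that powr_add[of y 1 "\<mu> - 1"] by simp
    have "(x + 1) powr \<mu> = x * (x + 1) powr (\<mu> - 1) + (x + 1) powr (\<mu> - 1)"
      using x by (subst e) (auto simp: algebra_simps)
    also have "\<dots> \<le> x * x powr (\<mu> - 1) + 1"
    proof (intro add_mono mult_left_mono)
      show "(x + 1) powr (\<mu> - 1) \<le> x powr (\<mu> - 1)" using x mu by (intro powr_mono2') auto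
      show "(x + 1) powr (\<mu> - 1) \<le> 1" using x mu powr_mono[of "\<mu> - 1" 0 "x + 1"] by simp
    qed (use x in auto)
    also have "x * x powr (\<mu> - 1) = x powr \<mu>" using e[OF x] by simp
    finally show ?thesis by (simp add: x_def add.commute)
  qed simp
  have "ln (1 + real (Suc m)) - ln (1 + real m) \<le> (1 + real (Suc m) - (1 + real m)) / (1 + real m)"
    by (rule ln_diff_le) auto
  also have "\<dots> \<le> 1" by simp
  finally have "ln (1 + real (Suc m)) \<le> ln (1 + real m) + 1" by linarith
  then have "real (Suc m) powr \<mu> + ln (1 + real (Suc m)) \<le> (real m powr \<mu> + ln (1 + real m)) + 2"
    using 1 by linarith
  then have "(real (Suc m) powr \<mu> + ln (1 + real (Suc m))) / 2 \<le> ((real m powr \<mu> + ln (1 + real m)) + 2) / 2"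
    by (rule divide_right_mono) simp
  then show ?thesis unfolding density_fun_def by (simp only: add_divide_distrib)
qed

lemma card_density_set: "real (card (density_set \<mu> \<inter> {..N})) = of_int \<lfloor>density_fun \<mu> (real N)\<rfloor>"
proof (induction N)
  case 0
  have "density_set \<mu> \<inter> {..0} = {}" by (auto simp: density_set_def)
  then show ?case by (simp add: density_fun_def)
next
  case (Suc N)
  have inc: "\<lfloor>density_fun \<mu> (real N)\<rfloor> \<le> \<lfloor>density_fun \<mu> (real (Suc N))\<rfloor>"
    "\<lfloor>density_fun \<mu> (real (Suc N))\<rfloor> \<le> \<lfloor>density_fun \<mu> (real N)\<rfloor> + 1"
  proof -
    show "\<lfloor>density_fun \<mu> (real N)\<rfloor> \<le> \<lfloor>density_fun \<mu> (real (Suc N))\<rfloor>"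
      by (intro floor_mono density_fun_mono) auto
    show "\<lfloor>density_fun \<mu> (real (Suc N))\<rfloor> \<le> \<lfloor>density_fun \<mu> (real N)\<rfloor> + 1"
      using floor_mono[OF density_fun_increment[of N]] by simp
  qed
  show ?case
  proof (cases "Suc N \<in> density_set \<mu>")
    case True
    then have "density_set \<mu> \<inter> {..Suc N} = insert (Suc N) (density_set \<mu> \<inter> {..N})"
      by (auto simp: le_Suc_eq)
    moreover have "\<lfloor>density_fun \<mu> (real N)\<rfloor> < \<lfloor>density_fun \<mu> (real (Suc N))\<rfloor>"
      using True by (simp add: density_set_def)
    ultimately show ?thesis using Suc inc by simp
  next
    case False
    then have "density_set \<mu> \<inter> {..Suc N} = density_set \<mu> \<inter> {..N}"
      by (auto simp: le_Suc_eq)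
    moreover have "\<lfloor>density_fun \<mu> (real N)\<rfloor> = \<lfloor>density_fun \<mu> (real (Suc N))\<rfloor>"
      using False inc by (auto simp: density_set_def)
    ultimately show ?thesis using Suc by simp
  qed
qed

lemma infinite_density_set: "infinite (density_set \<mu>)"
proof
  assume f: "finite (density_set \<mu>)"
  define c where "c = real (card (density_set \<mu>))"
  have "density_fun \<mu> (real N) < c + 1" for N
  proof -
    have "real (card (density_set \<mu> \<inter> {..N})) \<le> c"
      unfolding c_def using f by (intro of_nat_mono card_mono) auto
    then show ?thesis unfolding card_density_set by linarith
  qed
  moreover have "ln (1 + real N) / 2 \<le> density_fun \<mu> (real N)" for N
    by (simp add: density_fun_def)
  ultimately have "ln (1 + real N) / 2 < c + 1" for N
    using order.strict_trans1 by blast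
  then have "ln (1 + real N) < 2 * c + 2" for N
    by (simp add: mult.commute)
  moreover have "\<forall>\<^sub>F N in sequentially. ln (1 + real N) > 2 * c + 2" by real_asymp
  ultimately show False by (auto simp: eventually_sequentially dest: less_asym)
qed

lemma card_density_set_upper:
  assumes "e > 0"
  shows "\<forall>\<^sub>F R in at_top. \<forall>N. real N \<le> R \<longrightarrow> real (card (density_set \<mu> \<inter> {..N})) \<le> R powr (\<mu> + e)"
proof -
  have "\<forall>\<^sub>F R in at_top. density_fun \<mu> R \<le> R powr (\<mu> + e)"
  proof (cases "\<mu> = 0")
    case True
    then show ?thesis unfolding density_fun_def True using assms by real_asymp
  next
    case False
    then have "\<mu> > 0" using mu by simp
    then show ?thesis unfolding density_fun_def using assms by real_asymp
  qed
  then show ?thesis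
  proof eventually_elim
    case (elim R)
    show ?case
    proof (intro allI impI)
      fix N assume "real N \<le> R"
      then have "density_fun \<mu> (real N) \<le> density_fun \<mu> R" by (intro density_fun_mono) auto
      then show "real (card (density_set \<mu> \<inter> {..N})) \<le> R powr (\<mu> + e)"
        using elim unfolding card_density_set by linarith
    qed
  qed
qed

lemma card_density_set_lower:
  assumes "0 < e" "e < \<mu>"
  shows "\<forall>\<^sub>F R in at_top. real (card (density_set \<mu> \<inter> {..nat \<lfloor>R powr (1 - e/2)\<rfloor>})) \<ge> R powr (\<mu> - e)"
proof -
  define a b where "a = \<mu> - e" and "b = (1 - e/2) * \<mu> - (\<mu> - e)"
  have ab: "a > 0" "b > 0"
    using assms mu mult_strict_right_mono[of \<mu> 2 "e/2"] by (auto simp: a_def b_def algebra_simps)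
  have "\<forall>\<^sub>F R in at_top. R powr a \<le> 1/4 * R powr (a + b) - 1"
    using ab by real_asymp
  moreover have "\<forall>\<^sub>F R in at_top. R powr (1 - e/2) \<ge> 2"
    using assms mu by real_asymp
  ultimately show ?thesis
    using eventually_gt_at_top[of 0]
  proof eventually_elim
    case (elim R)
    define x where "x = R powr (1 - e/2)"
    define N where "N = nat \<lfloor>x\<rfloor>"
    have x: "x \<ge> 2" using elim by (simp add: x_def)
    have N: "real N \<ge> x / 2" using x unfolding N_def by linarith
    have "1/2 * R powr (a + b) = 1/2 * x powr \<mu>"
      by (simp add: x_def powr_powr a_def b_def)
    also have "\<dots> \<le> (1/2) powr \<mu> * x powr \<mu>"
      using mu powr_mono'[of \<mu> 1 "1/2::real"] by (intro mult_right_mono) auto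
    also have "\<dots> = (x/2) powr \<mu>"
      using x by (simp add: powr_mult[symmetric])
    also have "\<dots> \<le> real N powr \<mu>"
      using x N mu by (intro powr_mono2) auto
    also have "\<dots> \<le> 2 * density_fun \<mu> (real N)"
      by (simp add: density_fun_def)
    finally have "R powr a \<le> density_fun \<mu> (real N) - 1" using elim by linarith
    then show ?case
      unfolding card_density_set a_def[symmetric] x_def[symmetric] N_def[symmetric] by linarith
  qed
qed

end

text \<open>The parity of the lattice index serves as the sign of the corresponding zero: even indices will
  carry the zeros of \<open>f\<^sub>2\<close>, odd ones those of \<open>f\<^sub>1\<close>. The two classes thus have independent densities and share the
  spacing of one lattice.\<close>

definition even_odd_merge :: "nat set \<Rightarrow> nat set \<Rightarrow> nat set" where
  "even_odd_merge A B = (\<lambda>m. 2 * m) ` A \<union> (\<lambda>m. 2 * m + 1) ` B"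

text \<open>If \<open>m\<close> exceeded \<open>x = R / ln R powr (3/2)\<close>, then \<open>ln m\<close> would be at least about \<open>ln R\<close>, and \<open>m ln\<^sup>2 m\<close> would be at least
  about \<open>R (ln R) powr (1/2)\<close>.\<close>

lemma lattice_inverse_bound:
  assumes "D \<ge> 1"
  shows "\<forall>\<^sub>F R in at_top. \<forall>m. 9/10 * lattice D m \<le> R \<longrightarrow> real m \<le> R / ln R powr (3/2)"
proof -
  have "\<forall>\<^sub>F R in at_top. 9/10 * ((R / ln R powr (3/2)) * (ln (R / ln R powr (3/2)))\<^sup>2) > (R::real)"
    by real_asymp
  moreover have "\<forall>\<^sub>F R in at_top. R / ln R powr (3/2) > (1::real)"
    by real_asymp
  ultimately show ?thesis
  proof eventually_elim
    case (elim R)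
    define x where "x = R / ln R powr (3/2)"
    show ?case
    proof (intro allI impI, rule ccontr)
      fix m assume m: "9/10 * lattice D m \<le> R" "\<not> real m \<le> R / ln R powr (3/2)"
      have x: "x > 1" "real m \<ge> x" using elim m by (auto simp: x_def)
      have "x * (ln x)\<^sup>2 \<le> real m * (ln (real m + 2))\<^sup>2"
        using x by (intro mult_mono power_mono) auto
      also have "\<dots> \<le> lattice D m"
        using assms mult_right_mono[of 1 D "real m * (ln (real m + 2))\<^sup>2"] by (simp add: lattice_def mult.assoc)
      finally show False using m elim by (simp add: x_def)
    qed
  qed
qed

lemma lattice_upper_bound:
  assumes "D > 0" "0 < e" "e < 1"
  shows "\<forall>\<^sub>F R in at_top. \<forall>m. real m \<le> R powr (1 - e) \<longrightarrow> 11/10 * lattice D (2 * m + 1) \<le> R"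
proof -
  have "\<forall>\<^sub>F R in at_top. 11/10 * (D * (2 * R powr (1 - e) + 1) * (ln (2 * R powr (1 - e) + 3))\<^sup>2) \<le> R"
    using assms by real_asymp
  then show ?thesis
  proof eventually_elim
    case (elim R)
    show ?case
    proof (intro allI impI)
      fix m assume m: "real m \<le> R powr (1 - e)"
      have "lattice D (2 * m + 1) \<le> D * (2 * R powr (1 - e) + 1) * (ln (2 * R powr (1 - e) + 3))\<^sup>2"
        unfolding lattice_def using m assms(1) by (intro mult_mono power_mono) auto
      then show "11/10 * lattice D (2 * m + 1) \<le> R" using elim by linarith
    qed
  qed
qed

text \<open>The modulus \<open>1 / n\<close> of the prescribed values is the reason why the lattice constant \<open>D\<close> grows with
  \<open>ln n\<close>. The zeros satisfy \<open>9/10 Y\<^sub>j \<le> |\<zeta>\<^sub>j| \<le> 11/10 Y\<^sub>j\<close>, so their counting functions are those of the lattice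
  indices up to constant factors in \<open>R\<close>.\<close>

theorem exists_bank_laine_nodes:
  fixes n :: nat and \<mu>1 \<mu>2 :: real
  assumes "n > 0" and mu: "0 \<le> \<mu>1" "\<mu>1 \<le> 1" "0 \<le> \<mu>2" "\<mu>2 \<le> 1"
  obtains \<zeta> :: "nat \<Rightarrow> complex" and \<sigma> :: "nat \<Rightarrow> bool"
  where "inj \<zeta>" "\<And>j. norm (\<zeta> j) \<ge> 2" "\<And>j. \<bar>Re (\<zeta> j)\<bar> \<le> norm (\<zeta> j) / 9"
    "summable (\<lambda>j. norm (1 / \<zeta> j))"
    "\<And>k. exp (\<zeta> k) * genus_zero_product ((\<lambda>j. 1 / \<zeta> j)(k := 0)) (\<zeta> k) =
       (if \<sigma> k then - 1 / of_nat n else 1 / of_nat n)"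
    "\<And>R. finite {j. norm (\<zeta> j) \<le> R}"
    "\<forall>\<^sub>F R in at_top. real (card {j. norm (\<zeta> j) \<le> R}) \<le> R / ln R powr (3/2)"
    "\<And>s e. e > 0 \<Longrightarrow> \<forall>\<^sub>F R in at_top. real (card {j. \<sigma> j = s \<and> norm (\<zeta> j) \<le> R}) \<le> R powr ((if s then \<mu>2 else \<mu>1) + e)"
    "\<And>s e. 0 < e \<Longrightarrow> e < (if s then \<mu>2 else \<mu>1) \<Longrightarrow>
        \<forall>\<^sub>F R in at_top. real (card {j. \<sigma> j = s \<and> norm (\<zeta> j) \<le> R}) \<ge> R powr ((if s then \<mu>2 else \<mu>1) - e)"
proof -
  \<comment> \<open>The first summand gives \<open>10 / D \<le> 1 / 10000\<close>, the bound on the gap sums; the second gives \<open>ln n \<le> Y k / 100\<close>.\<close>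
  define D where "D = 100000 + 1000 * ln (real n)"
  have D: "D \<ge> 100000" "D > 0" "D \<ge> 1"
    using assms(1) by (auto simp: D_def intro: add_pos_nonneg add_increasing2)
  define \<mu> where "\<mu> s = (if s then \<mu>2 else \<mu>1)" for s
  have mus: "0 \<le> \<mu> s" "\<mu> s \<le> 1" for s using mu by (auto simp: \<mu>_def)
  define S where "S = even_odd_merge (density_set \<mu>2) (density_set \<mu>1)"
  have "infinite S"
    using infinite_density_set[of \<mu>2] mu
    by (auto simp: S_def even_odd_merge_def dest!: finite_imageD intro: inj_onI)
  define t where "t = enumerate S"
  have t: "inj t" "range t = S"
    using strict_mono_enumerate[OF \<open>infinite S\<close>] range_enumerate[OF \<open>infinite S\<close>]
    by (auto simp: t_def strict_mono_imp_inj_on)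
  have t_ge: "t j \<ge> 1" for j
  proof -
    have "t j \<in> S" using t(2) by auto
    then show ?thesis by (auto simp: S_def even_odd_merge_def density_set_def)
  qed
  define Y where "Y j = lattice D (t j)" for j
  interpret sparse_nodes Y
    unfolding Y_def using sparse_nodes_lattice[OF D(1) t(1) t_ge] .
  define \<sigma> where "\<sigma> j = even (t j)" for j
  define \<tau> where "\<tau> k = (if \<sigma> k then - 1 / complex_of_nat n else 1 / of_nat n)" for k
  have "norm (\<tau> k) = 1 / real n" for k by (simp add: \<tau>_def norm_divide)
  moreover have "1 / real n > 0" using assms(1) by simp
  moreover have "\<bar>ln (1 / real n)\<bar> \<le> Y k / 100" for k
  proof -
    have "D * 1 \<le> D * real (t k)" using D t_ge[of k] by (intro mult_left_mono) auto
    also have "\<dots> \<le> Y k" unfolding Y_def using lattice_ge D by blast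
    finally have "Y k \<ge> D" by simp
    moreover have "ln (real n) \<ge> 0" using assms(1) by simp
    ultimately have "ln (real n) \<le> Y k / 100" unfolding D_def by linarith
    then show ?thesis using assms(1) \<open>ln (real n) \<ge> 0\<close> by (simp add: ln_div)
  qed
  ultimately obtain \<zeta> where \<zeta>: "\<And>k. norm (\<zeta> k - \<i> * of_real (Y k)) \<le> Y k / 10" "inj \<zeta>"
    "\<And>k. exp (\<zeta> k) * genus_zero_product ((\<lambda>j. 1 / \<zeta> j)(k := 0)) (\<zeta> k) = \<tau> k"
    using exists_zeros_with_prescribed_products[of \<tau> "1 / real n"] by blast
  have n1: "norm (\<zeta> k) \<ge> 9/10 * Y k" and n2: "norm (\<zeta> k) \<le> 11/10 * Y k" for k
  proof -
    have "norm (\<i> * of_real (Y k)) = Y k" using Y_pos[of k] by (simp add: norm_mult)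
    then show "norm (\<zeta> k) \<ge> 9/10 * Y k" "norm (\<zeta> k) \<le> 11/10 * Y k"
      using \<zeta>(1)[of k] norm_triangle_ineq2[of "\<i> * of_real (Y k)" "\<zeta> k"]
        norm_triangle_ineq2[of "\<zeta> k" "\<i> * of_real (Y k)"] norm_minus_commute[of "\<zeta> k" "\<i> * of_real (Y k)"]
      by linarith+
  qed
  have t_mem: "t j \<in> S" for j using t(2) by auto
  have t_class: "t j = 2 * m \<Longrightarrow> m \<in> density_set \<mu>2" "t j = Suc (2 * m) \<Longrightarrow> m \<in> density_set \<mu>1" for j m
    using t_mem[of j] by (auto simp: S_def even_odd_merge_def) presburger+
  have half_le: "real (t j div 2) \<le> R \<and> real (t j) \<le> R" if "norm (\<zeta> j) \<le> R" for j R
  proof -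
    have "2 * real (t j) \<le> D * real (t j)" using D by (intro mult_right_mono) auto
    also have "\<dots> \<le> Y j" unfolding Y_def using lattice_ge D by blast
    finally have "9/5 * real (t j) \<le> R" using n1[of j] that by linarith
    moreover have "real (t j div 2) \<le> real (t j)" by simp
    ultimately show ?thesis using of_nat_0_le_iff[of "t j"] by linarith
  qed
  have fin: "finite {j. norm (\<zeta> j) \<le> R}" for R
  proof (rule finite_imageD[of t])
    show "finite (t ` {j. norm (\<zeta> j) \<le> R})"
      by (rule finite_subset[of _ "{..nat \<lfloor>R\<rfloor>}"]) (use half_le in \<open>force simp: le_nat_floor\<close>)+
  qed (use t(1) in \<open>auto intro: inj_on_subset\<close>)
  show thesis
  proof
    show "inj \<zeta>" by fact
    show "norm (\<zeta> j) \<ge> 2" for j using n1[of j] Y_ge[of j] by linarith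
    show "\<bar>Re (\<zeta> j)\<bar> \<le> norm (\<zeta> j) / 9" for j
      using abs_Re_le_cmod[of "\<zeta> j - \<i> * of_real (Y j)"] \<zeta>(1)[of j] n1[of j] by simp
    show "summable (\<lambda>j. norm (1 / \<zeta> j))"
    proof (rule summable_comparison_test')
      show "summable (\<lambda>j. 10/9 * (1 / Y j))" by (intro summable_mult summable_inverse_nodes)
      show "norm (norm (1 / \<zeta> j)) \<le> 10/9 * (1 / Y j)" for j
        using n1[of j] Y_pos[of j] frac_le[of 1 1 "9/10 * Y j" "norm (\<zeta> j)"] by (simp add: norm_divide)
    qed
    show "exp (\<zeta> k) * genus_zero_product ((\<lambda>j. 1 / \<zeta> j)(k := 0)) (\<zeta> k) =
       (if \<sigma> k then - 1 / of_nat n else 1 / of_nat n)" for k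
      using \<zeta>(3)[of k] by (simp add: \<tau>_def)
    show "finite {j. norm (\<zeta> j) \<le> R}" for R by (rule fin)
    show "\<forall>\<^sub>F R in at_top. real (card {j. norm (\<zeta> j) \<le> R}) \<le> R / ln R powr (3/2)"
      using lattice_inverse_bound[OF D(3)] eventually_gt_at_top[of 1]
    proof eventually_elim
      case (elim R)
      define x where "x = R / ln R powr (3/2)"
      have "card {j. norm (\<zeta> j) \<le> R} = card (t ` {j. norm (\<zeta> j) \<le> R})"
        using t(1) by (intro card_image[symmetric]) (auto intro: inj_on_subset)
      also have "\<dots> \<le> card {1..nat \<lfloor>x\<rfloor>}"
      proof (intro card_mono subsetI)
        fix m assume "m \<in> t ` {j. norm (\<zeta> j) \<le> R}"
        then obtain j where j: "m = t j" "norm (\<zeta> j) \<le> R" by auto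
        then have "9/10 * lattice D m \<le> R" using n1[of j] by (simp add: Y_def)
        then have "real m \<le> x" using elim by (simp add: x_def)
        then show "m \<in> {1..nat \<lfloor>x\<rfloor>}" using t_ge[of j] j by (simp add: le_nat_floor)
      qed simp
      also have "\<dots> = nat \<lfloor>x\<rfloor>" by simp
      finally have "real (card {j. norm (\<zeta> j) \<le> R}) \<le> real (nat \<lfloor>x\<rfloor>)" by simp
      also have "\<dots> \<le> x" using elim by (intro of_nat_floor) (auto simp: x_def)
      finally show ?case by (simp add: x_def)
    qed
    show "\<forall>\<^sub>F R in at_top. real (card {j. \<sigma> j = s \<and> norm (\<zeta> j) \<le> R}) \<le> R powr ((if s then \<mu>2 else \<mu>1) + e)"
      if "e > 0" for s e
      using card_density_set_upper[OF mus[of s] that] eventually_gt_at_top[of 1]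
    proof eventually_elim
      case (elim R)
      let ?J = "{j. \<sigma> j = s \<and> norm (\<zeta> j) \<le> R}"
      have "card ?J = card ((\<lambda>j. t j div 2) ` ?J)"
      proof (intro card_image[symmetric] inj_onI)
        fix i j assume ij: "i \<in> ?J" "j \<in> ?J" "t i div 2 = t j div 2"
        then have "even (t i) = even (t j)" by (auto simp: \<sigma>_def)
        then have "t i = t j" using ij(3) by presburger
        then show "i = j" using t(1) by (auto dest: injD)
      qed
      also have "\<dots> \<le> card (density_set (\<mu> s) \<inter> {..nat \<lfloor>R\<rfloor>})"
      proof (intro card_mono subsetI)
        fix m assume "m \<in> (\<lambda>j. t j div 2) ` ?J"
        then obtain j where j: "m = t j div 2" "\<sigma> j = s" "norm (\<zeta> j) \<le> R" by auto
        have "m \<in> density_set (\<mu> s)"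
          using j(1,2) t_class[of j m] by (cases s) (auto simp: \<sigma>_def \<mu>_def elim!: evenE oddE)
        then show "m \<in> density_set (\<mu> s) \<inter> {..nat \<lfloor>R\<rfloor>}"
          using half_le[OF j(3)] j(1) by (auto simp: le_nat_floor)
      qed simp
      finally have "real (card ?J) \<le> real (card (density_set (\<mu> s) \<inter> {..nat \<lfloor>R\<rfloor>}))" by simp
      also have "\<dots> \<le> R powr (\<mu> s + e)"
        using elim by (auto intro: of_nat_floor)
      finally show ?case by (simp add: \<mu>_def)
    qed
    show "\<forall>\<^sub>F R in at_top. real (card {j. \<sigma> j = s \<and> norm (\<zeta> j) \<le> R}) \<ge> R powr ((if s then \<mu>2 else \<mu>1) - e)"
      if "0 < e" "e < (if s then \<mu>2 else \<mu>1)" for s e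
    proof -
      have e: "e < \<mu> s" using that by (simp add: \<mu>_def)
      have e2: "0 < e/2" "e/2 < 1" using that(1) e mus(2)[of s] by auto
      show ?thesis
        using card_density_set_lower[OF mus[of s] that(1) e] lattice_upper_bound[OF D(2) e2] eventually_gt_at_top[of 1]
      proof eventually_elim
        case (elim R)
        let ?J = "{j. \<sigma> j = s \<and> norm (\<zeta> j) \<le> R}"
        have "card (density_set (\<mu> s) \<inter> {..nat \<lfloor>R powr (1 - e/2)\<rfloor>}) \<le> card ((\<lambda>j. t j div 2) ` ?J)"
        proof (intro card_mono subsetI)
          show "finite ((\<lambda>j. t j div 2) ` ?J)"
            by (intro finite_imageI finite_subset[OF _ fin[of R]]) auto
          fix m assume m: "m \<in> density_set (\<mu> s) \<inter> {..nat \<lfloor>R powr (1 - e/2)\<rfloor>}"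
          define p where "p = (if s then 2 * m else 2 * m + 1)"
          have "p \<in> S" using m by (auto simp: p_def S_def even_odd_merge_def \<mu>_def split: if_splits)
          then obtain j where j: "t j = p" using t(2) by auto
          have "real m \<le> R powr (1 - e/2)"
            using m by (auto simp: le_nat_iff le_floor_iff)
          then have "11/10 * lattice D (2 * m + 1) \<le> R" using elim by blast
          moreover have "lattice D p \<le> lattice D (2 * m + 1)"
            using strict_mono_less_eq[OF lattice_strict_mono[OF D(2)]] by (auto simp: p_def)
          ultimately have "norm (\<zeta> j) \<le> R" using n2[of j] by (simp add: Y_def j)
          moreover have "\<sigma> j = s" by (simp add: \<sigma>_def j p_def)
          ultimately have "j \<in> ?J" by simp
          moreover have "m = t j div 2" by (simp add: j p_def)
          ultimately show "m \<in> (\<lambda>j. t j div 2) ` ?J" by blast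
        qed
        also have "\<dots> \<le> card ?J"
          by (intro card_image_le finite_subset[OF _ fin[of R]]) auto
        finally have "real (card (density_set (\<mu> s) \<inter> {..nat \<lfloor>R powr (1 - e/2)\<rfloor>})) \<le> real (card ?J)" by simp
        then show ?case using elim by (simp add: \<mu>_def)
      qed
    qed
  qed
qed

section \<open>Lower bounds for the product away from its zeros\<close>

lemma exp_neg_le_one_minus:
  assumes "0 \<le> x" "x \<le> (1/2::real)"
  shows "exp (- 2 * x) \<le> 1 - x"
proof -
  have "- 2 * x \<le> - x - 2 * x\<^sup>2"
    using mult_left_mono[of x "1/2" x] assms by (simp add: power2_eq_square)
  also have "\<dots> \<le> ln (1 - x)" using ln_one_minus_pos_lower_bound[OF assms] .
  finally show ?thesis using assms by (simp add: ln_ge_iff)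
qed

context
  fixes \<zeta> :: "nat \<Rightarrow> complex"
  assumes zeta_ge: "\<And>j. norm (\<zeta> j) \<ge> 2"
    and summable_zeta: "summable (\<lambda>j. norm (1 / \<zeta> j))"
    and fin: "\<And>R. finite {j. norm (\<zeta> j) \<le> R}"
    and count: "\<forall>\<^sub>F R in at_top. real (card {j. norm (\<zeta> j) \<le> R}) \<le> R / ln R powr (3/2)"
begin

text \<open>Each of the \<open>o(R / ln R)\<close> factors with \<open>|\<zeta>\<^sub>j| \<le> 2 R\<close> is at least \<open>1 / (2 R)\<close>, since its numerator is
  the distance from \<open>z\<close> to \<open>\<zeta>\<^sub>j\<close>, so their product is at least \<open>exp (- o(R))\<close>. The others contribute at least
  \<open>exp (- 2 R t)\<close>, where \<open>t\<close> is a tail of the convergent series \<open>\<Sum>j. 1 / |\<zeta>\<^sub>j|\<close>.\<close>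

lemma norm_genus_zero_product_ge:
  assumes "e > 0"
  shows "\<forall>\<^sub>F R in at_top. \<forall>z. norm z \<le> R \<longrightarrow> (\<forall>j. norm (z - \<zeta> j) \<ge> 1) \<longrightarrow>
           norm (genus_zero_product (\<lambda>j. 1 / \<zeta> j) z) \<ge> exp (- e * R)"
proof -
  let ?p = "\<lambda>j. norm (1 / \<zeta> j)"
  obtain K where K: "norm (\<Sum>j. ?p (j + K)) < e / 4"
    using suminf_exist_split[OF _ summable_zeta, of "e/4"] assms by auto
  have sK: "summable (\<lambda>j. ?p (j + K))"
    using summable_zeta by (subst summable_iff_shift)
  have tail: "sum ?p F \<le> e / 4" if F: "finite F" "\<And>j. j \<in> F \<Longrightarrow> j \<ge> K" for F
  proof -
    have "sum ?p F = (\<Sum>i\<in>(\<lambda>j. j - K) ` F. ?p (i + K))"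
      using F(2) by (subst sum.reindex) (auto intro!: inj_onI sum.cong, metis le_add_diff_inverse2)
    also have "\<dots> \<le> (\<Sum>j. ?p (j + K))"
      by (rule sum_le_suminf[OF sK]) (use F(1) in auto)
    also have "\<dots> \<le> e / 4" using K by simp
    finally show ?thesis .
  qed
  have "filterlim (\<lambda>R::real. 2 * R) at_top at_top" by real_asymp
  from eventually_compose_filterlim[OF count this]
  have "\<forall>\<^sub>F R in at_top. real (card {j. norm (\<zeta> j) \<le> 2 * R}) \<le> 2 * R / ln (2 * R) powr (3/2)" .
  moreover have "\<forall>\<^sub>F R::real in at_top. 2 * R / ln (2 * R) powr (3/2) * ln (2 * R) \<le> e / 2 * R"
    using assms by real_asymp
  moreover have "\<forall>\<^sub>F R in at_top. \<forall>j<K. norm (\<zeta> j) \<le> 2 * R"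
  proof -
    have "\<forall>\<^sub>F R in at_top. (\<Sum>j<K. norm (\<zeta> j)) \<le> R" by (rule eventually_ge_at_top)
    then show ?thesis
      using eventually_ge_at_top[of 0]
    proof eventually_elim
      case (elim R)
      then show ?case
        using member_le_sum[of _ "{..<K}" "\<lambda>j. norm (\<zeta> j)"] by fastforce
    qed
  qed
  ultimately show ?thesis
    using eventually_ge_at_top[of 1]
  proof eventually_elim
    case (elim R)
    define J where "J = {j. norm (\<zeta> j) \<le> 2 * R}"
    have R: "R \<ge> 1" by fact
    show ?case
    proof (intro allI impI)
      fix z assume z: "norm z \<le> R" "\<forall>j. norm (z - \<zeta> j) \<ge> 1"
      have near: "1 / (2 * R) \<le> norm (1 - z * (1 / \<zeta> j))" if "j \<in> J" for j
      proof -
        have "\<zeta> j \<noteq> 0" using zeta_ge[of j] by auto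
        then have "norm (1 - z * (1 / \<zeta> j)) = norm (z - \<zeta> j) / norm (\<zeta> j)"
          by (simp add: norm_divide[symmetric] diff_divide_distrib norm_minus_commute)
        moreover have "1 / (2 * R) \<le> norm (z - \<zeta> j) / norm (\<zeta> j)"
          using z(2) that zeta_ge[of j] R by (intro frac_le) (auto simp: J_def)
        ultimately show ?thesis by simp
      qed
      have far: "exp (- 2 * (R * ?p j)) \<le> norm (1 - z * (1 / \<zeta> j))" if "j \<notin> J" for j
      proof -
        have "R / norm (\<zeta> j) \<le> R / (2 * R)"
          using that R by (intro divide_left_mono mult_pos_pos) (auto simp: J_def)
        then have "R * ?p j \<le> 1/2"
          using R by (simp add: norm_divide)
        then have "exp (- 2 * (R * ?p j)) \<le> 1 - R * ?p j"
          using R by (intro exp_neg_le_one_minus) auto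
        also have "\<dots> \<le> 1 - norm (z * (1 / \<zeta> j))"
          using mult_right_mono[OF z(1), of "?p j"] by (simp add: norm_mult norm_divide)
        also have "\<dots> \<le> norm (1 - z * (1 / \<zeta> j))"
          using norm_triangle_ineq2[of 1 "z * (1 / \<zeta> j)"] by simp
        finally show ?thesis .
      qed
      have "exp (- e * R) \<le> norm (\<Prod>j<N. 1 - z * (1 / \<zeta> j))" for N
      proof -
        define A B where "A = {..<N} \<inter> J" and "B = {..<N} - J"
        have AB: "{..<N} = A \<union> B" "A \<inter> B = {}" "finite A" "finite B" by (auto simp: A_def B_def)
        have "exp (- (e / 2) * R) \<le> (1 / (2 * R)) ^ card A"
        proof -
          have "card A \<le> card J" using fin[of "2 * R"] by (intro card_mono) (auto simp: A_def J_def)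
          then have "real (card A) * ln (2 * R) \<le> real (card J) * ln (2 * R)"
            using R by (intro mult_right_mono) auto
          also have "\<dots> \<le> 2 * R / ln (2 * R) powr (3/2) * ln (2 * R)"
            using elim R unfolding J_def by (intro mult_right_mono) auto
          also have "\<dots> \<le> e / 2 * R" using elim by simp
          finally have "exp (- (e / 2) * R) \<le> exp (real (card A) * ln (1 / (2 * R)))"
            using R by (simp add: ln_div)
          also have "\<dots> = (1 / (2 * R)) ^ card A"
            using R by (simp add: exp_of_nat_mult)
          finally show ?thesis .
        qed
        also have "\<dots> = (\<Prod>j\<in>A. 1 / (2 * R))" by simp
        also have "\<dots> \<le> (\<Prod>j\<in>A. norm (1 - z * (1 / \<zeta> j)))"
          using near R by (intro prod_mono) (auto simp: A_def)
        finally have 1: "exp (- (e / 2) * R) \<le> (\<Prod>j\<in>A. norm (1 - z * (1 / \<zeta> j)))" .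
        have "R * sum ?p B \<le> R * (e / 4)"
        proof (intro mult_left_mono tail)
          fix j assume "j \<in> B"
          then have "\<not> norm (\<zeta> j) \<le> 2 * R" by (simp add: B_def J_def)
          then show "j \<ge> K" using elim(3) not_le by blast
        qed (use R AB in auto)
        then have "exp (- (e / 2) * R) \<le> exp (\<Sum>j\<in>B. - 2 * (R * ?p j))"
          by (simp only: sum_distrib_left[symmetric] exp_le_cancel_iff) (simp add: mult_ac)
        also have "\<dots> = (\<Prod>j\<in>B. exp (- 2 * (R * ?p j)))"
          using AB by (simp add: exp_sum)
        also have "\<dots> \<le> (\<Prod>j\<in>B. norm (1 - z * (1 / \<zeta> j)))"
          using far by (intro prod_mono) (auto simp: B_def)
        finally have 2: "exp (- (e / 2) * R) \<le> (\<Prod>j\<in>B. norm (1 - z * (1 / \<zeta> j)))" .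
        have "exp (- e * R) = exp (- (e / 2) * R) * exp (- (e / 2) * R)" by (simp flip: exp_add)
        also have "\<dots> \<le> (\<Prod>j\<in>A. norm (1 - z * (1 / \<zeta> j))) * (\<Prod>j\<in>B. norm (1 - z * (1 / \<zeta> j)))"
          using 1 2 by (intro mult_mono) (auto intro: prod_nonneg)
        also have "\<dots> = norm (\<Prod>j<N. 1 - z * (1 / \<zeta> j))"
          unfolding AB(1) prod_norm[symmetric] by (rule prod.union_disjoint[symmetric]) (use AB in auto)
        finally show ?thesis .
      qed
      then show "exp (- e * R) \<le> norm (genus_zero_product (\<lambda>j. 1 / \<zeta> j) z)"
        by (intro tendsto_lowerbound[OF tendsto_norm[OF genus_zero_product_LIMSEQ[OF summable_zeta]]]) auto
    qed
  qed
qed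

text \<open>Pigeonhole: about \<open>R / 2\<close> radii at mutual distance \<open>2\<close> fit into \<open>[R, 2 R]\<close>, each \<open>|\<zeta>\<^sub>j|\<close> is at distance less than \<open>1\<close> from at most
  one of them, and there are only \<open>o(R)\<close> relevant zeros.\<close>

lemma exists_radius_avoiding_zeros:
  "\<forall>\<^sub>F R in at_top. \<exists>\<rho>. R \<le> \<rho> \<and> \<rho> \<le> 2 * R \<and> (\<forall>j. \<bar>norm (\<zeta> j) - \<rho>\<bar> \<ge> 1)"
proof -
  have "filterlim (\<lambda>R::real. 3 * R) at_top at_top" by real_asymp
  from eventually_compose_filterlim[OF count this]
  have "\<forall>\<^sub>F R in at_top. real (card {j. norm (\<zeta> j) \<le> 3 * R}) \<le> 3 * R / ln (3 * R) powr (3/2)" .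
  moreover have "\<forall>\<^sub>F R::real in at_top. 3 * R / ln (3 * R) powr (3/2) < R / 4" by real_asymp
  ultimately show ?thesis
    using eventually_ge_at_top[of 4]
  proof eventually_elim
    case (elim R)
    define N where "N = nat \<lfloor>R / 2\<rfloor>"
    have N: "real N \<le> R / 2" "real N \<ge> R / 4" using elim unfolding N_def by linarith+
    show ?case
    proof (rule ccontr)
      assume neg: "\<not> ?thesis"
      have "\<exists>j. \<bar>norm (\<zeta> j) - (R + 2 * real i)\<bar> < 1" if "i < N" for i
      proof -
        have "real i \<le> real N" using that by simp
        then have "R \<le> R + 2 * real i" "R + 2 * real i \<le> 2 * R" using N by linarith+
        then show ?thesis using neg by (meson not_le)
      qed
      then obtain f where f: "\<And>i. i < N \<Longrightarrow> \<bar>norm (\<zeta> (f i)) - (R + 2 * real i)\<bar> < 1" by metis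
      have "inj_on f {..<N}"
      proof (rule inj_onI)
        fix i k assume "i \<in> {..<N}" "k \<in> {..<N}" "f i = f k"
        then have "\<bar>2 * real i - 2 * real k\<bar> < 2" using f[of i] f[of k] by (simp add: abs_less_iff)
        then show "i = k" by linarith
      qed
      then have "N = card (f ` {..<N})" by (simp add: card_image)
      also have "\<dots> \<le> card {j. norm (\<zeta> j) \<le> 3 * R}"
      proof (intro card_mono fin subsetI)
        fix j assume "j \<in> f ` {..<N}"
        then obtain i where i: "i < N" "j = f i" by auto
        then have "real i \<le> real N" by simp
        then show "j \<in> {j. norm (\<zeta> j) \<le> 3 * R}" using f[OF i(1)] i(2) N elim(3) by (simp add: abs_less_iff)
      qed
      finally have "real N \<le> real (card {j. norm (\<zeta> j) \<le> 3 * R})" by simp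
      then show False using elim N by linarith
    qed
  qed
qed

end

section \<open>Bank--Laine functions as products of normalized solutions\<close>

text \<open>At a zero of \<open>E\<close> the quotient \<open>N / E\<close> has the limit \<open>N' / E'\<close>, so the singularity is removable.\<close>

lemma entire_quotient_of_simple_zeros:
  assumes N: "N holomorphic_on UNIV" and E: "E holomorphic_on UNIV"
    and zeros: "\<And>z. E z = 0 \<Longrightarrow> N z = 0 \<and> deriv E z \<noteq> 0"
  obtains k where "k holomorphic_on UNIV" "\<And>z. N z = k z * E z"
proof
  define k where "k z = (if E z = 0 then deriv N z / deriv E z else N z / E z)" for z
  show "N z = k z * E z" for z
    using zeros[of z] by (simp add: k_def)
  have "\<exists>U. open U \<and> z \<in> U \<and> k holomorphic_on U" for z
  proof (cases "E z = 0")
    case False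
    define U where "U = {w. E w \<noteq> 0}"
    have "open U"
      unfolding U_def using holomorphic_on_imp_continuous_on[OF E]
      by (intro open_Collect_neq) auto
    moreover have "k holomorphic_on U"
    proof (rule holomorphic_transform)
      show "(\<lambda>w. N w / E w) holomorphic_on U"
        by (intro holomorphic_intros holomorphic_on_subset[OF N] holomorphic_on_subset[OF E]) (auto simp: U_def)
    qed (auto simp: U_def k_def)
    ultimately show ?thesis using False by (auto simp: U_def)
  next
    case True
    have dE: "((\<lambda>w. E w / (w - z)) \<longlongrightarrow> deriv E z) (at z)"
      using holomorphic_derivI[OF E, of z] True by (simp add: has_field_derivative_iff)
    have dN: "((\<lambda>w. N w / (w - z)) \<longlongrightarrow> deriv N z) (at z)"
      using holomorphic_derivI[OF N, of z] zeros[OF True] by (simp add: has_field_derivative_iff)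
    have nz: "deriv E z \<noteq> 0" using zeros[OF True] by simp
    have "\<forall>\<^sub>F w in at z. E w / (w - z) \<noteq> 0"
      using tendsto_imp_eventually_ne[OF dE nz] .
    then have ev: "\<forall>\<^sub>F w in at z. E w \<noteq> 0" by eventually_elim auto
    then obtain r where r: "r > 0" "\<And>w. w \<noteq> z \<Longrightarrow> dist w z < r \<Longrightarrow> E w \<noteq> 0"
      unfolding eventually_at by auto
    have "((\<lambda>w. (N w / (w - z)) / (E w / (w - z))) \<longlongrightarrow> deriv N z / deriv E z) (at z)"
      by (intro tendsto_divide dE dN nz)
    moreover have "\<forall>\<^sub>F w in at z. (N w / (w - z)) / (E w / (w - z)) = k w"
      using ev eventually_neq_at_within[of z z UNIV] by eventually_elim (auto simp: k_def)
    ultimately have "(k \<longlongrightarrow> deriv N z / deriv E z) (at z)"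
      by (rule Lim_transform_eventually)
    then have lim: "(k \<longlongrightarrow> k z) (at z)"
      using True by (simp add: k_def[of z])
    have "k holomorphic_on ball z r"
    proof (rule no_isolated_singularity'[of "{z}"])
      show "(k \<longlongrightarrow> k w) (at w within ball z r)" if "w \<in> {z}" for w
        using that lim by (auto intro: tendsto_within_subset)
      show "k holomorphic_on ball z r - {z}"
      proof (rule holomorphic_transform)
        show "(\<lambda>w. N w / E w) holomorphic_on ball z r - {z}"
          by (intro holomorphic_intros holomorphic_on_subset[OF N] holomorphic_on_subset[OF E])
            (use r in \<open>auto simp: dist_commute\<close>)
      qed (use r in \<open>auto simp: k_def dist_commute\<close>)
    qed auto
    then show ?thesis using r(1) by (intro exI[of _ "ball z r"]) auto
  qed
  then show "k holomorphic_on UNIV"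
    by (metis holomorphic_on_imp_differentiable_at holomorphic_onI field_differentiable_at_within)
qed

text \<open>Differentiating the Wronskian gives \<open>f\<^sub>1 f\<^sub>2'' = f\<^sub>1'' f\<^sub>2\<close>, hence \<open>f\<^sub>1'' / f\<^sub>1 = f\<^sub>2'' / f\<^sub>2\<close>. The formula for
  \<open>A\<close> represents the negative of this quotient without a division, which makes it visibly entire. The last identity
  follows from \<open>E'\<^sup>2 - 1 = (f\<^sub>1 f\<^sub>2' + f\<^sub>1' f\<^sub>2)\<^sup>2 - (f\<^sub>1 f\<^sub>2' - f\<^sub>1' f\<^sub>2)\<^sup>2 = 4 E f\<^sub>1' f\<^sub>2'\<close>.\<close>

lemma normalized_solutions_of_wronskian_1:
  assumes f1: "f1 holomorphic_on UNIV" and f2: "f2 holomorphic_on UNIV"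
    and W: "\<And>z. f1 z * deriv f2 z - deriv f1 z * f2 z = 1"
  defines "A \<equiv> \<lambda>z. deriv f1 z * deriv (deriv f2) z - deriv (deriv f1) z * deriv f2 z"
    and "E \<equiv> \<lambda>z. f1 z * f2 z"
  shows "A holomorphic_on UNIV" "normalized_solutions A f1 f2"
    "4 * A z * (E z)\<^sup>2 = (deriv E z)\<^sup>2 - 2 * E z * deriv (deriv E) z - 1"
proof -
  have d1: "deriv f1 holomorphic_on UNIV" "deriv f2 holomorphic_on UNIV"
    using f1 f2 by (auto intro: holomorphic_deriv)
  have d2: "deriv (deriv f1) holomorphic_on UNIV" "deriv (deriv f2) holomorphic_on UNIV"
    using d1 by (auto intro: holomorphic_deriv)
  show "A holomorphic_on UNIV"
    unfolding A_def by (intro holomorphic_intros d1 d2)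
  note D = holomorphic_derivI[OF f1 open_UNIV UNIV_I] holomorphic_derivI[OF f2 open_UNIV UNIV_I]
    holomorphic_derivI[OF d1(1) open_UNIV UNIV_I] holomorphic_derivI[OF d1(2) open_UNIV UNIV_I]
  have W': "f1 z * deriv (deriv f2) z = deriv (deriv f1) z * f2 z" for z
  proof -
    have "((\<lambda>z. f1 z * deriv f2 z - deriv f1 z * f2 z) has_field_derivative
        f1 z * deriv (deriv f2) z - deriv (deriv f1) z * f2 z) (at z)"
      by (auto intro!: derivative_eq_intros D simp: algebra_simps)
    moreover have "((\<lambda>z. f1 z * deriv f2 z - deriv f1 z * f2 z) has_field_derivative 0) (at z)"
      unfolding W by simp
    ultimately show ?thesis using DERIV_unique by fastforce
  qed
  have s1: "deriv (deriv f1) z + A z * f1 z = 0" for z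
  proof -
    have "A z * f1 z = deriv f1 z * (f1 z * deriv (deriv f2) z) - deriv (deriv f1) z * (f1 z * deriv f2 z)"
      by (simp add: A_def algebra_simps)
    also have "\<dots> = deriv (deriv f1) z * (deriv f1 z * f2 z - f1 z * deriv f2 z)"
      unfolding W' by (simp add: algebra_simps)
    also have "deriv f1 z * f2 z - f1 z * deriv f2 z = - 1" using W[of z] by (simp add: algebra_simps)
    finally show ?thesis by simp
  qed
  have s2: "deriv (deriv f2) z + A z * f2 z = 0" for z
  proof -
    have "A z * f2 z = deriv (deriv f2) z * (deriv f1 z * f2 z) - deriv f2 z * (deriv (deriv f1) z * f2 z)"
      by (simp add: A_def algebra_simps)
    also have "\<dots> = deriv (deriv f2) z * (deriv f1 z * f2 z - f1 z * deriv f2 z)"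
      unfolding W'[symmetric] by (simp add: algebra_simps)
    also have "deriv f1 z * f2 z - f1 z * deriv f2 z = - 1" using W[of z] by (simp add: algebra_simps)
    finally show ?thesis by simp
  qed
  have "lin_indep f1 f2"
    unfolding lin_indep_def
  proof (intro allI impI)
    fix a b assume ab: "\<forall>z. a * f1 z + b * f2 z = 0"
    have d: "a * deriv f1 z + b * deriv f2 z = 0" for z
    proof -
      have "((\<lambda>z. a * f1 z + b * f2 z) has_field_derivative a * deriv f1 z + b * deriv f2 z) (at z)"
        by (auto intro!: derivative_eq_intros D)
      moreover have "((\<lambda>z. a * f1 z + b * f2 z) has_field_derivative 0) (at z)"
        using ab by simp
      ultimately show ?thesis using DERIV_unique by blast
    qed
    have a: "a * (f1 0 * deriv f2 0 - deriv f1 0 * f2 0) =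
        (a * f1 0 + b * f2 0) * deriv f2 0 - (a * deriv f1 0 + b * deriv f2 0) * f2 0"
      by (simp add: algebra_simps)
    have b: "b * (f1 0 * deriv f2 0 - deriv f1 0 * f2 0) =
        (a * deriv f1 0 + b * deriv f2 0) * f1 0 - (a * f1 0 + b * f2 0) * deriv f1 0"
      by (simp add: algebra_simps)
    show "a = 0 \<and> b = 0" using a b unfolding W[of 0] d[of 0] ab[rule_format, of 0] by simp
  qed
  then show "normalized_solutions A f1 f2"
    unfolding normalized_solutions_def is_solution_def using f1 f2 s1 s2 W by blast
  have E1: "deriv E = (\<lambda>z. deriv f1 z * f2 z + f1 z * deriv f2 z)"
    by (rule ext, rule DERIV_imp_deriv) (auto simp: E_def algebra_simps intro!: derivative_eq_intros D)
  have E2: "deriv (deriv E) z = deriv (deriv f1) z * f2 z + 2 * deriv f1 z * deriv f2 z + f1 z * deriv (deriv f2) z"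
    unfolding E1 by (rule DERIV_imp_deriv) (auto simp: algebra_simps intro!: derivative_eq_intros D)
  have "(deriv E z)\<^sup>2 - 1 = (deriv E z)\<^sup>2 - (f1 z * deriv f2 z - deriv f1 z * f2 z)\<^sup>2"
    by (simp add: W)
  also have "\<dots> = 4 * E z * (deriv f1 z * deriv f2 z)"
    unfolding E1 by (simp add: E_def power2_eq_square algebra_simps)
  finally have a: "(deriv E z)\<^sup>2 - 1 = 4 * E z * (deriv f1 z * deriv f2 z)" .
  have b: "deriv (deriv E) z = - 2 * A z * E z + 2 * (deriv f1 z * deriv f2 z)"
  proof -
    have "deriv (deriv f1) z = - (A z * f1 z)" "deriv (deriv f2) z = - (A z * f2 z)"
      by (simp_all add: eq_neg_iff_add_eq_0 s1 s2)
    then show ?thesis unfolding E2 by (simp add: E_def algebra_simps)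
  qed
  have "(deriv E z)\<^sup>2 - 2 * E z * deriv (deriv E) z - 1 =
      ((deriv E z)\<^sup>2 - 1) - 2 * E z * deriv (deriv E) z"
    by simp
  also have "\<dots> = 4 * E z * (deriv f1 z * deriv f2 z) -
      2 * E z * (- 2 * A z * E z + 2 * (deriv f1 z * deriv f2 z))"
    by (simp only: a b)
  also have "\<dots> = 4 * A z * (E z)\<^sup>2"
    by (simp add: algebra_simps power2_eq_square)
  finally show "4 * A z * (E z)\<^sup>2 = (deriv E z)\<^sup>2 - 2 * E z * deriv (deriv E) z - 1" ..
qed

text \<open>For \<open>f\<^sub>1 = g\<^sub>1 exp h\<close> and \<open>f\<^sub>2 = g\<^sub>2 exp(- h)\<close> the Wronskian is \<open>g\<^sub>1 g\<^sub>2' - g\<^sub>1' g\<^sub>2 - 2 h' E\<close>. It equals \<open>1\<close> if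
  \<open>2 h' = (g\<^sub>1 g\<^sub>2' - g\<^sub>1' g\<^sub>2 - 1) / E\<close>, and the sign conditions say exactly that the numerator vanishes at the
  zeros of \<open>E\<close>, which are simple.\<close>

theorem bank_laine_factorization:
  assumes g1: "g1 holomorphic_on UNIV" and g2: "g2 holomorphic_on UNIV"
    and E_def: "E = (\<lambda>z. g1 z * g2 z)"
    and z1: "\<And>z. g1 z = 0 \<Longrightarrow> deriv E z = -1" and z2: "\<And>z. g2 z = 0 \<Longrightarrow> deriv E z = 1"
  obtains A f1 f2 where
    "A holomorphic_on UNIV" "normalized_solutions A f1 f2" "E = (\<lambda>z. f1 z * f2 z)"
    "\<And>z. f1 z = 0 \<longleftrightarrow> g1 z = 0" "\<And>z. f2 z = 0 \<longleftrightarrow> g2 z = 0"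
    "\<And>z. 4 * A z * (E z)\<^sup>2 = (deriv E z)\<^sup>2 - 2 * E z * deriv (deriv E) z - 1"
proof -
  have d: "deriv g1 holomorphic_on UNIV" "deriv g2 holomorphic_on UNIV"
    using g1 g2 by (auto intro: holomorphic_deriv)
  note D = holomorphic_derivI[OF g1 open_UNIV UNIV_I] holomorphic_derivI[OF g2 open_UNIV UNIV_I]
  have dE: "deriv E z = deriv g1 z * g2 z + g1 z * deriv g2 z" for z
    by (rule DERIV_imp_deriv) (auto simp: E_def algebra_simps intro!: derivative_eq_intros D)
  define N where "N z = g1 z * deriv g2 z - deriv g1 z * g2 z - 1" for z
  have "N holomorphic_on UNIV" "E holomorphic_on UNIV"
    unfolding N_def E_def by (auto intro!: holomorphic_intros g1 g2 d)
  moreover have "N z = 0 \<and> deriv E z \<noteq> 0" if "E z = 0" for z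
  proof (cases "g1 z = 0")
    case True
    then have "deriv g1 z * g2 z = -1" using z1[OF True] dE[of z] by simp
    then show ?thesis using True z1[OF True] by (simp add: N_def)
  next
    case False
    then have "g2 z = 0" using that by (simp add: E_def)
    moreover from this have "g1 z * deriv g2 z = 1" using z2[of z] dE[of z] by simp
    ultimately show ?thesis using z2[of z] by (simp add: N_def)
  qed
  ultimately obtain k where k: "k holomorphic_on UNIV" "\<And>z. N z = k z * E z"
    using entire_quotient_of_simple_zeros by metis
  have "(\<lambda>z. k z / 2) holomorphic_on UNIV" by (intro holomorphic_intros k) simp
  then obtain h where h: "\<And>z. (h has_field_derivative k z / 2) (at z)"
    using holomorphic_convex_primitive'[of UNIV "\<lambda>z. k z / 2"] by auto
  have hh: "h holomorphic_on UNIV" using h by (auto simp: holomorphic_on_open)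
  define f1 f2 where "f1 z = g1 z * exp (h z)" and "f2 z = g2 z * exp (- h z)" for z
  have f: "f1 holomorphic_on UNIV" "f2 holomorphic_on UNIV"
    unfolding f1_def f2_def by (auto intro!: holomorphic_intros g1 g2 hh)
  have df1: "deriv f1 z = (deriv g1 z + g1 z * (k z / 2)) * exp (h z)" for z
    unfolding f1_def by (rule DERIV_imp_deriv) (auto simp: algebra_simps intro!: derivative_eq_intros D h)
  have df2: "deriv f2 z = (deriv g2 z - g2 z * (k z / 2)) * exp (- h z)" for z
    unfolding f2_def by (rule DERIV_imp_deriv) (auto simp: algebra_simps intro!: derivative_eq_intros D h)
  have ee: "exp (h z) * exp (- h z) = 1" for z by (simp flip: exp_add)
  have W: "f1 z * deriv f2 z - deriv f1 z * f2 z = 1" for z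
  proof -
    have "f1 z * deriv f2 z - deriv f1 z * f2 z =
       (exp (h z) * exp (- h z)) * (g1 z * deriv g2 z - deriv g1 z * g2 z - k z * (g1 z * g2 z))"
      by (simp add: f1_def f2_def df1 df2 field_simps)
    also have "\<dots> = 1" using k(2)[of z] unfolding ee by (simp add: N_def E_def algebra_simps)
    finally show ?thesis .
  qed
  have E: "E = (\<lambda>z. f1 z * f2 z)"
    using ee by (auto simp: E_def f1_def f2_def mult_ac)
  note sol = normalized_solutions_of_wronskian_1[OF f W]
  show thesis
  proof (rule that[OF sol(1,2) E])
    show "f1 z = 0 \<longleftrightarrow> g1 z = 0" "f2 z = 0 \<longleftrightarrow> g2 z = 0" for z
      by (simp_all add: f1_def f2_def)
    show "4 * (deriv f1 z * deriv (deriv f2) z - deriv (deriv f1) z * deriv f2 z) * (E z)\<^sup>2 =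
        (deriv E z)\<^sup>2 - 2 * E z * deriv (deriv E) z - 1" for z
      using sol(3)[of z] unfolding E .
  qed
qed

section \<open>Computing orders and exponents of convergence\<close>

lemma Limsup_log_ratio_eqI:
  fixes G :: "real \<Rightarrow> real"
  assumes "l \<ge> 0"
    and upper: "\<And>e. e > 0 \<Longrightarrow> \<forall>\<^sub>F r in at_top. G r \<le> r powr (l + e)"
    and lower: "\<And>e. 0 < e \<Longrightarrow> e < l \<Longrightarrow> \<forall>\<^sub>F r in at_top. r powr (l - e) \<le> G r"
  shows "Limsup at_top (\<lambda>r. ereal (log_plus (G r) / ln r)) = ereal l"
proof (rule lim_imp_Limsup)
  have "((\<lambda>r. log_plus (G r) / ln r) \<longlongrightarrow> l) at_top"
  proof (rule tendstoI)
    fix e :: real assume "e > 0"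
    have "\<forall>\<^sub>F r in at_top. l - e / 2 \<le> log_plus (G r) / ln r"
    proof (cases "e / 2 < l")
      case True
      have "\<forall>\<^sub>F r in at_top. r powr (l - e / 2) \<le> G r"
        using lower[of "e/2"] True \<open>e > 0\<close> by simp
      then show ?thesis
        using eventually_gt_at_top[of 1]
      proof eventually_elim
        case (elim r)
        then have "ln (r powr (l - e / 2)) \<le> log_plus (G r)"
          unfolding log_plus_def by (subst ln_le_cancel_iff) auto
        then show ?case using elim by (simp add: ln_powr field_simps)
      qed
    next
      case False
      show ?thesis
        using eventually_gt_at_top[of 1]
      proof eventually_elim
        case (elim r)
        then have "log_plus (G r) / ln r \<ge> 0" by (simp add: log_plus_def)
        then show ?case using False by linarith
      qed
    qed
    moreover have "\<forall>\<^sub>F r in at_top. log_plus (G r) / ln r \<le> l + e / 2"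
      using upper[of "e/2", simplified, OF \<open>e > 0\<close>] eventually_gt_at_top[of 1]
    proof eventually_elim
      case (elim r)
      have "1 \<le> r powr (l + e / 2)"
        using elim assms(1) \<open>e > 0\<close> by (intro ge_one_powr_ge_zero) auto
      then have "log_plus (G r) \<le> ln (r powr (l + e / 2))"
        unfolding log_plus_def using elim by (subst ln_le_cancel_iff) auto
      then show ?case using elim by (simp add: ln_powr field_simps)
    qed
    ultimately show "\<forall>\<^sub>F r in at_top. dist (log_plus (G r) / ln r) l < e"
      by eventually_elim (use \<open>e > 0\<close> in \<open>auto simp: dist_real_def abs_less_iff\<close>)
  qed
  then show "((\<lambda>r. ereal (log_plus (G r) / ln r)) \<longlongrightarrow> ereal l) at_top"
    by (rule tendsto_ereal)
qed simp

lemma log_plus_nonneg: "log_plus x \<ge> 0"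
  by (simp add: log_plus_def)

lemma log_plus_le: "x \<le> exp y \<Longrightarrow> 0 \<le> y \<Longrightarrow> log_plus x \<le> y"
  using ln_le_cancel_iff[of "max 1 x" "exp y"] by (simp add: log_plus_def)

lemma log_plus_ge: "exp y \<le> x \<Longrightarrow> y \<le> log_plus x"
  unfolding log_plus_def by (subst ln_ge_iff) auto

lemma continuous_log_plus_circle:
  assumes "f holomorphic_on UNIV"
  shows "continuous_on S (\<lambda>t. log_plus (cmod (f (of_real r * cis t))))"
proof -
  have "continuous_on S (\<lambda>t. f (of_real r * cis t))"
    by (rule continuous_on_compose2[OF holomorphic_on_imp_continuous_on[OF assms]])
      (auto intro!: continuous_intros)
  then show ?thesis
    unfolding log_plus_def by (intro continuous_intros) (auto simp: max_def)
qed

text \<open>A lower bound on a fixed arc suffices, because the proximity function is an integral of a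
  nonnegative function over the circle.\<close>

lemma growth_order_eqI:
  fixes n :: nat
  assumes "n > 0" and f: "f holomorphic_on UNIV"
    and C: "\<forall>\<^sub>F r in at_top. \<forall>z. cmod z = r \<longrightarrow> cmod (f z) \<le> exp (C * r ^ n)"
    and c: "c > 0" and ab: "0 \<le> a" "a < b" "b \<le> 2 * pi"
    and lower: "\<forall>\<^sub>F r in at_top. \<forall>t\<in>{a..b}. exp (c * r ^ n) \<le> cmod (f (of_real r * cis t))"
  shows "growth_order f = ereal (real n)"
  unfolding growth_order_def
proof (rule Limsup_log_ratio_eqI)
  define D where "D = max C 1"
  have T: "nevanlinna_characteristic r f = 1 / (2 * pi) * integral {0..2 * pi} (\<lambda>t. log_plus (cmod (f (of_real r * cis t))))" for r
    by (simp add: nevanlinna_characteristic_entire[OF f] nevanlinna_proximity_def)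
  note int = integrable_continuous_real[OF continuous_log_plus_circle[OF f]]
  fix e :: real
  {
    assume "e > 0"
    have "\<forall>\<^sub>F r in at_top. nevanlinna_characteristic r f \<le> D * r ^ n"
      using C eventually_gt_at_top[of 0]
    proof eventually_elim
      case (elim r)
      have "integral {0..2 * pi} (\<lambda>t. log_plus (cmod (f (of_real r * cis t)))) \<le> integral {0..2*pi} (\<lambda>t. D * r ^ n)"
      proof (rule integral_le[OF int integrable_const_ivl])
        fix t
        have "C * r ^ n \<le> D * r ^ n" using elim by (intro mult_right_mono) (auto simp: D_def)
        moreover have "cmod (of_real r * cis t) = r" using elim by (simp add: norm_mult)
        ultimately have "cmod (f (of_real r * cis t)) \<le> exp (D * r ^ n)"
          using elim by (meson exp_le_cancel_iff order_trans)
        then show "log_plus (cmod (f (of_real r * cis t))) \<le> D * r ^ n"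
          using elim by (intro log_plus_le) (auto simp: D_def)
      qed
      also have "\<dots> = 2 * pi * (D * r ^ n)" by simp
      finally show ?case unfolding T by (simp add: field_simps)
    qed
    moreover have "\<forall>\<^sub>F r in at_top. D * r ^ n \<le> r powr (real n + e)"
    proof -
      have "\<forall>\<^sub>F r in at_top. D \<le> r powr e" using \<open>e > 0\<close> by real_asymp
      then show ?thesis
        using eventually_gt_at_top[of 0]
        by eventually_elim (auto simp: powr_add powr_realpow mult.commute intro: mult_left_mono)
    qed
    ultimately show "\<forall>\<^sub>F r in at_top. nevanlinna_characteristic r f \<le> r powr (real n + e)"
      by eventually_elim simp
  }
  {
    assume "0 < e" "e < real n"
    define d where "d = (b - a) * c / (2 * pi)"
    have d: "d > 0" using ab c by (simp add: d_def)
    have "\<forall>\<^sub>F r in at_top. d * r ^ n \<le> nevanlinna_characteristic r f"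
      using lower eventually_gt_at_top[of 0]
    proof eventually_elim
      case (elim r)
      have "(b - a) * (c * r ^ n) = integral {a..b} (\<lambda>t. c * r ^ n)"
        using ab by simp
      also have "\<dots> \<le> integral {a..b} (\<lambda>t. log_plus (cmod (f (of_real r * cis t))))"
        by (rule integral_le[OF integrable_const_ivl int]) (use elim in \<open>auto intro: log_plus_ge\<close>)
      also have "\<dots> \<le> integral {0..2*pi} (\<lambda>t. log_plus (cmod (f (of_real r * cis t))))"
        by (rule integral_subset_le[OF _ int int]) (use ab in \<open>auto simp: log_plus_nonneg\<close>)
      finally have "(b - a) * (c * r ^ n) / (2 * pi) \<le> nevanlinna_characteristic r f"
        unfolding T by (simp add: divide_right_mono)
      then show ?case by (simp add: d_def)
    qed
    moreover have "\<forall>\<^sub>F r in at_top. r powr (real n - e) \<le> d * r ^ n"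
    proof -
      have "\<forall>\<^sub>F r in at_top. r powr (- e) \<le> d" using \<open>e > 0\<close> d by real_asymp
      then show ?thesis
        using eventually_gt_at_top[of 0]
      proof eventually_elim
        case (elim r)
        have "r powr (real n - e) = r powr (- e) * r ^ n"
          using elim by (simp add: powr_realpow[symmetric] powr_add[symmetric])
        then show ?case using elim by (simp add: mult_right_mono)
      qed
    qed
    ultimately show "\<forall>\<^sub>F r in at_top. r powr (real n - e) \<le> nevanlinna_characteristic r f"
      by eventually_elim simp
  }
qed simp

text \<open>Apart from the origin, the zeros of \<open>f\<close> are \<open>n\<close>-th roots of the \<open>\<zeta>\<^sub>j\<close>, so they are counted up to the radius \<open>r\<close> by the \<open>\<zeta>\<^sub>j\<close> up to the
  radius \<open>r\<^sup>n\<close>, with at most \<open>n\<close> roots for each. Separate predicates for the upper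
  and the lower count allow for a product in which one class of zeros dominates the other.\<close>

lemma exponent_of_convergence_power_zeros:
  fixes \<zeta> :: "nat \<Rightarrow> complex" and n :: nat
  assumes "n > 0" and f: "f holomorphic_on UNIV"
    and simple: "\<And>z. f z = 0 \<Longrightarrow> deriv f z \<noteq> 0"
    and zeros: "\<And>z. f z = 0 \<Longrightarrow> z = 0 \<or> (\<exists>j. P j \<and> z ^ n = \<zeta> j)"
    and zeros': "\<And>z j. P' j \<Longrightarrow> z ^ n = \<zeta> j \<Longrightarrow> f z = 0"
    and inj: "inj \<zeta>" and fin: "\<And>R. finite {j. norm (\<zeta> j) \<le> R}" and "\<mu> \<ge> 0"
    and upper: "\<And>e. e > 0 \<Longrightarrow> \<forall>\<^sub>F R in at_top. real (card {j. P j \<and> norm (\<zeta> j) \<le> R}) \<le> R powr (\<mu> + e)"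
    and lower: "\<And>e. 0 < e \<Longrightarrow> e < \<mu> \<Longrightarrow> \<forall>\<^sub>F R in at_top. real (card {j. P' j \<and> norm (\<zeta> j) \<le> R}) \<ge> R powr (\<mu> - e)"
  shows "exponent_of_convergence f = ereal (real n * \<mu>)"
proof -
  have zc: "zero_count r f = card {z. cmod z \<le> r \<and> f z = 0}" for r
  proof -
    have "zorder f z = 1" if "f z = 0" for z
      by (rule zorder_zero_eqI[OF f]) (use that simple[OF that] in auto)
    then show ?thesis unfolding zero_count_def by simp
  qed
  define J where "J Q r = {j. Q j \<and> norm (\<zeta> j) \<le> r ^ n}" for Q r
  have finJ: "finite (J Q r)" for Q r
    unfolding J_def by (rule finite_subset[OF _ fin[of "r ^ n"]]) auto
  have sub: "{z. cmod z \<le> r \<and> f z = 0} \<subseteq> {0} \<union> (\<Union>j\<in>J P r. {z. z ^ n = \<zeta> j})" for r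
  proof
    fix z assume "z \<in> {z. cmod z \<le> r \<and> f z = 0}"
    then have z: "cmod z \<le> r" "f z = 0" by auto
    show "z \<in> {0} \<union> (\<Union>j\<in>J P r. {z. z ^ n = \<zeta> j})"
    proof (cases "z = 0")
      case False
      then obtain j where j: "P j" "z ^ n = \<zeta> j" using zeros z by blast
      have "norm (\<zeta> j) = cmod z ^ n" using j(2) by (metis norm_power)
      then have "j \<in> J P r" using j z by (auto simp: J_def intro!: power_mono)
      then show ?thesis using j by auto
    qed simp
  qed
  have fin_roots: "finite {z. z ^ n = w}" for w :: complex
    using assms(1) by (rule finite_nth_roots)
  have card_roots: "card {z. z ^ n = w} \<le> n" for w :: complex
    using card_nth_roots[of w n] assms(1) by (cases "w = 0") auto
  have finZ: "finite {z. cmod z \<le> r \<and> f z = 0}" for r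
    by (rule finite_subset[OF sub]) (use finJ fin_roots in auto)
  have up: "real (zero_count r f) \<le> 1 + real n * real (card (J P r))" for r
  proof -
    have "zero_count r f \<le> card ({0} \<union> (\<Union>j\<in>J P r. {z. z ^ n = \<zeta> j}))"
      unfolding zc by (rule card_mono[OF _ sub]) (use finJ fin_roots in auto)
    also have "\<dots> \<le> card {0::complex} + card (\<Union>j\<in>J P r. {z. z ^ n = \<zeta> j})"
      by (rule card_Un_le)
    also have "card (\<Union>j\<in>J P r. {z. z ^ n = \<zeta> j}) \<le> (\<Sum>j\<in>J P r. card {z. z ^ n = \<zeta> j})"
      by (rule card_UN_le[OF finJ])
    also have "\<dots> \<le> (\<Sum>j\<in>J P r. n)" by (intro sum_mono card_roots)
    finally have "zero_count r f \<le> 1 + n * card (J P r)" by (simp add: mult.commute)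
    then show ?thesis by (metis of_nat_1 of_nat_add of_nat_le_iff of_nat_mult)
  qed
  have lo: "card (J P' r) \<le> zero_count r f" if "r > 0" for r
  proof -
    have "card (J P' r) = card (\<zeta> ` J P' r)"
      using inj by (intro card_image[symmetric]) (auto intro: inj_on_subset)
    also have "\<dots> \<le> card ((\<lambda>z. z ^ n) ` {z. cmod z \<le> r \<and> f z = 0})"
    proof (intro card_mono finite_imageI finZ subsetI)
      fix w assume "w \<in> \<zeta> ` J P' r"
      then obtain j where j: "w = \<zeta> j" "P' j" "norm (\<zeta> j) \<le> r ^ n" by (auto simp: J_def)
      obtain z where "\<zeta> j = z ^ n"
        using exists_complex_root[of n "\<zeta> j"] assms(1) by auto
      then have z: "z ^ n = \<zeta> j" by simp
      have "cmod z ^ n \<le> r ^ n" using j(3) z by (metis norm_power)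
      then have "cmod z \<le> r" using assms(1) that by (simp add: power_mono_iff)
      moreover have "f z = 0" using zeros'[OF j(2) z] .
      ultimately show "w \<in> (\<lambda>z. z ^ n) ` {z. cmod z \<le> r \<and> f z = 0}"
        using z j(1) by (intro image_eqI[of _ _ z]) auto
    qed
    also have "\<dots> \<le> zero_count r f" unfolding zc by (rule card_image_le[OF finZ])
    finally show ?thesis .
  qed
  have pow: "filterlim (\<lambda>r::real. r ^ n) at_top at_top"
    using assms(1) by (intro filterlim_pow_at_top filterlim_ident)
  have powr_pow: "(r ^ n) powr x = r powr (real n * x)" if "r > 0" for r x :: real
    using that by (simp add: powr_realpow[symmetric] powr_powr)
  show ?thesis
    unfolding exponent_of_convergence_def
  proof (rule Limsup_log_ratio_eqI)
    fix e :: real assume e: "e > 0"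
    define a where "a = real n * \<mu> + e / 2"
    have a: "a > 0" using e assms(1) \<open>\<mu> \<ge> 0\<close> by (simp add: a_def add_nonneg_pos)
    have "e / (2 * real n) > 0" using e assms(1) by simp
    from eventually_compose_filterlim[OF upper[OF this] pow]
    have "\<forall>\<^sub>F r in at_top. real (card (J P r)) \<le> (r ^ n) powr (\<mu> + e / (2 * real n))"
      by (simp add: J_def)
    moreover have "\<forall>\<^sub>F r in at_top. 1 + real n * r powr a \<le> r powr (a + e / 2)"
      using a e assms(1) by real_asymp
    ultimately show "\<forall>\<^sub>F r in at_top. real (zero_count r f) \<le> r powr (real n * \<mu> + e)"
      using eventually_gt_at_top[of 0]
    proof eventually_elim
      case (elim r)
      have "real n * (\<mu> + e / (2 * real n)) = a"
        using assms(1) by (simp add: a_def distrib_left)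
      then have "(r ^ n) powr (\<mu> + e / (2 * real n)) = r powr a"
        by (simp only: powr_pow[OF elim(3)])
      then have "real n * real (card (J P r)) \<le> real n * r powr a"
        using elim by (intro mult_left_mono) auto
      then have "real (zero_count r f) \<le> r powr (a + e / 2)" using up[of r] elim by linarith
      then show ?case by (simp add: a_def add.commute)
    qed
  next
    fix e :: real assume e: "0 < e" "e < real n * \<mu>"
    have "0 < e / real n" "e / real n < \<mu>" using e assms(1) by (auto simp: field_simps)
    from eventually_compose_filterlim[OF lower[OF this] pow]
    have "\<forall>\<^sub>F r in at_top. real (card (J P' r)) \<ge> (r ^ n) powr (\<mu> - e / real n)"
      by (simp add: J_def)
    then show "\<forall>\<^sub>F r in at_top. r powr (real n * \<mu> - e) \<le> real (zero_count r f)"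
      using eventually_gt_at_top[of 0]
    proof eventually_elim
      case (elim r)
      have "real n * (\<mu> - e / real n) = real n * \<mu> - e"
        using assms(1) by (simp add: right_diff_distrib)
      then have "(r ^ n) powr (\<mu> - e / real n) = r powr (real n * \<mu> - e)"
        by (simp only: powr_pow[OF elim(2)])
      then show ?case using elim(1) lo[OF elim(2)] by linarith
    qed
  qed (use assms in auto)
qed

section \<open>The Bank--Laine function of a solved system of nodes\<close>

lemma norm_power_diff_le:
  fixes z w :: complex
  assumes "norm z \<le> M" "norm w \<le> M"
  shows "norm (w ^ n - z ^ n) \<le> real n * M ^ (n - 1) * norm (w - z)"
proof (rule field_differentiable_bound[of "cball 0 M"])
  fix x :: complex assume "x \<in> cball 0 M"
  then show "norm (of_nat n * x ^ (n - 1)) \<le> real n * M ^ (n - 1)"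
    by (simp add: norm_mult norm_power mult_left_mono power_mono)
  show "((\<lambda>x. x ^ n) has_field_derivative of_nat n * x ^ (n - 1)) (at x within cball 0 M)"
    by (auto intro!: derivative_eq_intros)
qed (use assms in auto)

lemma cauchy_derivative_bounds:
  assumes E: "E holomorphic_on UNIV" and B: "\<And>w. norm (w - z) \<le> 1 \<Longrightarrow> norm (E w) \<le> B"
  shows "norm (deriv E z) \<le> B" "norm (deriv (deriv E) z) \<le> 2 * B"
proof -
  have c: "continuous_on (cball z 1) E"
    using holomorphic_on_imp_continuous_on holomorphic_on_subset[OF E] by blast
  have *: "norm ((deriv ^^ k) E z) \<le> fact k * B / 1 ^ k" for k
    by (rule Cauchy_inequality[OF holomorphic_on_subset[OF E] c]) (auto intro!: B simp: norm_minus_commute)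
  from *[of 1] *[of 2] show "norm (deriv E z) \<le> B" "norm (deriv (deriv E) z) \<le> 2 * B"
    by (simp_all add: numeral_2_eq_2)
qed

text \<open>The hypothesis \<open>node_values\<close> says \<open>E' = 1\<close> at the roots of \<open>\<zeta> k\<close> if \<open>\<sigma> k\<close> and \<open>E' = - 1\<close> otherwise, for
  the function \<open>E\<close> below. The bound on \<open>Re (\<zeta> j)\<close> keeps the zeros away from sectors around the real axis.\<close>

locale bank_laine_nodes =
  fixes n :: nat and \<zeta> :: "nat \<Rightarrow> complex" and \<sigma> :: "nat \<Rightarrow> bool"
  assumes n: "n > 0"
    and zeta_ge: "\<And>j. norm (\<zeta> j) \<ge> 2"
    and zeta_Re: "\<And>j. \<bar>Re (\<zeta> j)\<bar> \<le> norm (\<zeta> j) / 9"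
    and summable_zeta: "summable (\<lambda>j. norm (1 / \<zeta> j))"
    and node_values: "\<And>k. exp (\<zeta> k) * genus_zero_product ((\<lambda>j. 1 / \<zeta> j)(k := 0)) (\<zeta> k) =
       (if \<sigma> k then - 1 / of_nat n else 1 / of_nat n)"
    and fin: "\<And>R. finite {j. norm (\<zeta> j) \<le> R}"
    and count: "\<forall>\<^sub>F R in at_top. real (card {j. norm (\<zeta> j) \<le> R}) \<le> R / ln R powr (3/2)"
begin

abbreviation Q :: "complex \<Rightarrow> complex" where "Q \<equiv> genus_zero_product (\<lambda>j. 1 / \<zeta> j)"

definition E :: "complex \<Rightarrow> complex" where "E z = z * Q (z ^ n) * exp (z ^ n)"

definition g1 :: "complex \<Rightarrow> complex" where
  "g1 z = genus_zero_product (\<lambda>j. if \<sigma> j then 0 else 1 / \<zeta> j) (z ^ n)"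

text \<open>The zero at the origin belongs to this factor because \<open>E' 0 = 1\<close>.\<close>

definition g2 :: "complex \<Rightarrow> complex" where
  "g2 z = z * genus_zero_product (\<lambda>j. if \<sigma> j then 1 / \<zeta> j else 0) (z ^ n) * exp (z ^ n)"

lemma zeta_nz: "\<zeta> j \<noteq> 0"
  using zeta_ge[of j] by auto

lemma summable_parts:
  "summable (\<lambda>j. norm (if \<sigma> j then 0 else 1 / \<zeta> j))" "summable (\<lambda>j. norm (if \<sigma> j then 1 / \<zeta> j else 0))"
  by (rule summable_comparison_test[OF _ summable_zeta]; auto)+

lemma entire_power_compose:
  "f holomorphic_on UNIV \<Longrightarrow> (\<lambda>z::complex. f (z ^ n)) holomorphic_on UNIV"
  using holomorphic_on_compose[of "\<lambda>z. z ^ n" UNIV f, OF holomorphic_on_power[OF holomorphic_on_ident]]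
  by (simp add: o_def holomorphic_on_subset[of f UNIV])

lemma entire_parts: "E holomorphic_on UNIV" "g1 holomorphic_on UNIV" "g2 holomorphic_on UNIV"
  unfolding E_def g1_def g2_def
  by (intro holomorphic_intros entire_power_compose genus_zero_product_entire summable_zeta summable_parts)+

lemma E_eq: "E = (\<lambda>z. g1 z * g2 z)"
proof
  fix z
  have "(\<lambda>j. (if \<sigma> j then 0 else 1 / \<zeta> j) + (if \<sigma> j then 1 / \<zeta> j else 0)) = (\<lambda>j. 1 / \<zeta> j)"
    by auto
  then show "E z = g1 z * g2 z"
    using genus_zero_product_mult[OF summable_parts, of "z ^ n"] by (simp add: E_def g1_def g2_def)
qed

lemma g1_eq_0_iff: "g1 z = 0 \<longleftrightarrow> (\<exists>j. \<not> \<sigma> j \<and> z ^ n = \<zeta> j)"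
  unfolding g1_def genus_zero_product_eq_0_iff[OF summable_parts(1)]
  using zeta_nz by (auto simp: field_simps split: if_splits)

lemma g2_eq_0_iff: "g2 z = 0 \<longleftrightarrow> z = 0 \<or> (\<exists>j. \<sigma> j \<and> z ^ n = \<zeta> j)"
  unfolding g2_def using genus_zero_product_eq_0_iff[OF summable_parts(2), of "z ^ n"]
  using zeta_nz by (auto simp: field_simps split: if_splits)

text \<open>All the \<open>n\<close> roots of \<open>\<zeta> k\<close> give the same value, because the derivative involves the root \<open>z\<close> only
  through \<open>z * z ^ (n - 1) = \<zeta> k\<close>.\<close>

lemma deriv_E_at_node:
  assumes z: "z ^ n = \<zeta> k"
  shows "deriv E z = (if \<sigma> k then 1 else - 1)"
proof -
  define G where "G z = z * genus_zero_product ((\<lambda>j. 1 / \<zeta> j)(k := 0)) (z ^ n) * exp (z ^ n)" for z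
  have G: "G holomorphic_on UNIV"
    unfolding G_def
    by (intro holomorphic_intros entire_power_compose genus_zero_product_entire summable_norm_fun_upd_0 summable_zeta)
  have E: "E = (\<lambda>z. (1 - z ^ n / \<zeta> k) * G z)"
    by (auto simp: E_def G_def genus_zero_product_extract_factor[OF summable_zeta, of _ k])
  have zz: "z * z ^ (n - 1) = \<zeta> k"
    using n z by (metis power_eq_if not_gr_zero)
  have "(E has_field_derivative (- (of_nat n * z ^ (n - 1) / \<zeta> k) * G z)) (at z)"
    unfolding E using zeta_nz[of k] z
    by (auto intro!: derivative_eq_intros holomorphic_derivI[OF G])
  then have "deriv E z = - (of_nat n * z ^ (n - 1) / \<zeta> k) * G z" by (rule DERIV_imp_deriv)
  also have "\<dots> = - of_nat n * ((z * z ^ (n - 1)) / \<zeta> k) *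
      (exp (\<zeta> k) * genus_zero_product ((\<lambda>j. 1 / \<zeta> j)(k := 0)) (\<zeta> k))"
    by (simp add: G_def z)
  also have "\<dots> = (if \<sigma> k then 1 else - 1)"
    unfolding node_values zz using zeta_nz[of k] n by simp
  finally show ?thesis .
qed

lemma deriv_E_0: "deriv E 0 = 1"
proof -
  define H where "H z = Q (z ^ n) * exp (z ^ n)" for z
  have H: "H holomorphic_on UNIV"
    unfolding H_def by (intro holomorphic_intros entire_power_compose genus_zero_product_entire summable_zeta)
  have "E = (\<lambda>z. z * H z)" by (auto simp: E_def H_def)
  then have "(E has_field_derivative H 0) (at 0)"
    by (auto intro!: derivative_eq_intros holomorphic_derivI[OF H])
  then have "deriv E 0 = H 0" by (rule DERIV_imp_deriv)
  also have "H 0 = 1"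
    using n by (simp add: H_def zero_power genus_zero_product_at_0[OF summable_zeta])
  finally show ?thesis .
qed

lemma deriv_E_zeros: "g1 z = 0 \<Longrightarrow> deriv E z = -1" "g2 z = 0 \<Longrightarrow> deriv E z = 1"
  using deriv_E_at_node deriv_E_0 by (auto simp: g1_eq_0_iff g2_eq_0_iff)

lemma power_at_top: "filterlim (\<lambda>r::real. r ^ n) at_top at_top"
  using n by (intro filterlim_pow_at_top filterlim_ident)

lemma norm_E: "norm (E z) = cmod z * norm (Q (z ^ n)) * exp (Re (z ^ n))"
  by (simp add: E_def norm_mult)

lemma norm_E_le:
  assumes "e > 0"
  shows "\<forall>\<^sub>F r in at_top. \<forall>z. cmod z \<le> r \<longrightarrow> norm (E z) \<le> r * exp (e * r ^ n) * exp (Re (z ^ n))"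
  using eventually_compose_filterlim[OF norm_genus_zero_product_le[OF summable_zeta assms] power_at_top]
    eventually_ge_at_top[of 0]
proof eventually_elim
  case (elim r)
  show ?case
  proof (intro allI impI)
    fix z assume z: "cmod z \<le> r"
    have "norm (z ^ n) \<le> r ^ n" using z by (simp add: norm_power power_mono)
    then have "norm (Q (z ^ n)) \<le> exp (e * r ^ n)" using elim by blast
    then show "norm (E z) \<le> r * exp (e * r ^ n) * exp (Re (z ^ n))"
      unfolding norm_E using z elim by (intro mult_mono) auto
  qed
qed

lemma norm_E_ge:
  assumes "e > 0"
  shows "\<forall>\<^sub>F r in at_top. \<forall>z. cmod z = r \<longrightarrow> (\<forall>j. norm (z ^ n - \<zeta> j) \<ge> 1) \<longrightarrow>
           norm (E z) \<ge> r * exp (- e * r ^ n) * exp (Re (z ^ n))"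
  using eventually_compose_filterlim[OF norm_genus_zero_product_ge[OF zeta_ge summable_zeta fin count assms] power_at_top]
    eventually_ge_at_top[of 0]
proof eventually_elim
  case (elim r)
  show ?case
  proof (intro allI impI)
    fix z assume z: "cmod z = r" "\<forall>j. norm (z ^ n - \<zeta> j) \<ge> 1"
    have "norm (z ^ n) \<le> r ^ n" using z by (simp add: norm_power)
    then have "norm (Q (z ^ n)) \<ge> exp (- e * r ^ n)" using elim z by blast
    then show "norm (E z) \<ge> r * exp (- e * r ^ n) * exp (Re (z ^ n))"
      unfolding norm_E using z elim by (intro mult_mono) auto
  qed
qed

text \<open>The nodes lie in a narrow double sector around the imaginary axis, and \<open>s\<close> lies in one around the real axis.\<close>

lemma dist_nodes_ge_1:
  assumes "norm s \<ge> 4" "norm s / 2 \<le> \<bar>Re s\<bar>"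
  shows "norm (s - \<zeta> j) \<ge> 1"
proof (rule ccontr)
  assume "\<not> norm (s - \<zeta> j) \<ge> 1"
  then have d: "norm (s - \<zeta> j) < 1" by simp
  have "norm (\<zeta> j) \<le> norm s + norm (s - \<zeta> j)"
    using norm_triangle_ineq2[of "\<zeta> j" s] by (simp add: norm_minus_commute)
  moreover have "\<bar>Re s\<bar> \<le> \<bar>Re (\<zeta> j)\<bar> + norm (s - \<zeta> j)"
    using abs_Re_le_cmod[of "s - \<zeta> j"] by simp
  ultimately show False using d zeta_Re[of j] assms by linarith
qed

lemma E_le_exp: "\<forall>\<^sub>F r in at_top. \<forall>z. cmod z \<le> r \<longrightarrow> norm (E z) \<le> exp (3 * r ^ n)"
  using norm_E_le[OF zero_less_one] eventually_ge_at_top[of 1]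
proof eventually_elim
  case (elim r)
  show ?case
  proof (intro allI impI)
    fix z assume z: "cmod z \<le> r"
    have "r ^ 1 \<le> r ^ n" using elim n by (intro power_increasing) auto
    then have r: "r \<le> exp (r ^ n)"
      using exp_ge_add_one_self[of "r ^ n"] unfolding power_one_right by linarith
    have "Re (z ^ n) \<le> norm (z ^ n)" by (rule complex_Re_le_cmod)
    also have "\<dots> \<le> r ^ n" using z by (simp add: norm_power power_mono)
    finally have "r * exp (r ^ n) * exp (Re (z ^ n)) \<le> exp (r ^ n) * exp (r ^ n) * exp (r ^ n)"
      using r elim by (intro mult_mono) auto
    also have "\<dots> = exp (3 * r ^ n)" by (simp flip: exp_add)
    finally show "norm (E z) \<le> exp (3 * r ^ n)" using elim z by fastforce
  qed
qed

lemma growth_order_E: "growth_order E = ereal (real n)"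
proof (rule growth_order_eqI[OF n entire_parts(1)])
  \<comment> \<open>On the arc \<open>Re (z\<^sup>n) \<ge> r\<^sup>n / 2\<close>, and the product costs at most a factor \<open>exp (- r\<^sup>n / 4)\<close>.\<close>
  have quarter: "0 < (1/4 :: real)" by simp
  show "\<forall>\<^sub>F r in at_top. \<forall>z. cmod z = r \<longrightarrow> cmod (E z) \<le> exp (3 * r ^ n)"
    using E_le_exp by eventually_elim auto
  show "\<forall>\<^sub>F r in at_top. \<forall>t\<in>{0..pi / (3 * real n)}. exp (1/4 * r ^ n) \<le> cmod (E (of_real r * cis t))"
    using norm_E_ge[OF quarter] eventually_compose_filterlim[OF eventually_ge_at_top[of 4] power_at_top]
      eventually_ge_at_top[of 1]
  proof eventually_elim
    case (elim r)
    show ?case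
    proof
      fix t assume t: "t \<in> {0..pi / (3 * real n)}"
      define z where "z = of_real r * cis t"
      have zn: "z ^ n = of_real (r ^ n) * cis (real n * t)"
        by (simp only: z_def power_mult_distrib of_real_power Complex.DeMoivre)
      have "real n * t \<le> pi / 3" using t n by (simp add: field_simps)
      then have "cos (pi / 3) \<le> cos (real n * t)"
        using t by (intro cos_monotone_0_pi_le) auto
      then have "r ^ n * (1/2) \<le> r ^ n * cos (real n * t)"
        using elim by (intro mult_left_mono) (auto simp: cos_60)
      then have Re: "Re (z ^ n) \<ge> r ^ n / 2" unfolding zn by simp
      have nz: "cmod z = r" "norm (z ^ n) = r ^ n" using elim by (auto simp: z_def norm_mult norm_power)
      have "\<forall>j. norm (z ^ n - \<zeta> j) \<ge> 1"
        using dist_nodes_ge_1[of "z ^ n"] nz Re elim by simp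
      then have "r * exp (- (1/4) * r ^ n) * exp (Re (z ^ n)) \<le> norm (E z)" using elim nz by fastforce
      moreover have "1 * exp (- (1/4) * r ^ n) * exp (r ^ n / 2) \<le> r * exp (- (1/4) * r ^ n) * exp (Re (z ^ n))"
        using elim Re by (intro mult_mono) auto
      moreover have "1 * exp (- (1/4) * r ^ n) * exp (r ^ n / 2) = exp (1/4 * r ^ n)"
        by (simp flip: exp_add)
      ultimately have "exp (1/4 * r ^ n) \<le> norm (E z)" by linarith
      then show "exp (1/4 * r ^ n) \<le> cmod (E (of_real r * cis t))"
        by (simp only: z_def)
    qed
  qed
  show "pi / (3 * real n) \<le> 2 * pi" using n by (simp add: field_simps)
qed (use n in auto)

context
  fixes A :: "complex \<Rightarrow> complex"
  assumes A: "A holomorphic_on UNIV"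
    and A_eq: "\<And>z. 4 * A z * (E z)\<^sup>2 = (deriv E z)\<^sup>2 - 2 * E z * deriv (deriv E) z - 1"
begin

text \<open>On circles that avoid the zeros, \<open>4 A E\<^sup>2 = E'\<^sup>2 - 2 E E'' - 1\<close> and the lower bound for \<open>|E|\<close> give the estimate.
  The maximum principle extends it to all points, at the cost of doubling \<open>r\<^sup>n\<close>.\<close>

lemma A_le_exp:
  obtains C where "\<forall>\<^sub>F r in at_top. \<forall>z. cmod z \<le> r \<longrightarrow> norm (A z) \<le> exp (C * r ^ n)"
proof -
  define K where "K = 3 * 2 ^ n + (1::real)"
  have bound: "\<forall>\<^sub>F r in at_top. \<forall>z. cmod z = r \<longrightarrow> (\<forall>j. norm (z ^ n - \<zeta> j) \<ge> 1) \<longrightarrow>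
      norm (A z) \<le> exp ((2 * K + 4) * r ^ n)"
  proof -
    have "filterlim (\<lambda>r::real. 2 * r) at_top at_top" by real_asymp
    from eventually_compose_filterlim[OF E_le_exp this]
    have "\<forall>\<^sub>F r in at_top. \<forall>z. cmod z \<le> 2 * r \<longrightarrow> norm (E z) \<le> exp (3 * (2 * r) ^ n)" .
    moreover have "\<forall>\<^sub>F r in at_top. \<forall>z. cmod z = r \<longrightarrow> (\<forall>j. norm (z ^ n - \<zeta> j) \<ge> 1) \<longrightarrow>
           norm (E z) \<ge> r * exp (- 1 * r ^ n) * exp (Re (z ^ n))"
      by (rule norm_E_ge) simp
    moreover have "\<forall>\<^sub>F r in at_top. (2::real) \<le> r ^ n"
      by (rule eventually_compose_filterlim[OF eventually_ge_at_top power_at_top])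
    ultimately show ?thesis
      using eventually_ge_at_top[of 1]
    proof eventually_elim
      case (elim r)
      show ?case
      proof (intro allI impI)
        fix z assume z: "cmod z = r" "\<forall>j. norm (z ^ n - \<zeta> j) \<ge> 1"
        define R where "R = r ^ n"
        have R: "R \<ge> 2" using elim by (simp add: R_def)
        define B where "B = exp (3 * 2 ^ n * R)"
        have B1: "B \<ge> 1" using R by (simp add: B_def)
        have B: "norm (E w) \<le> B" if "norm (w - z) \<le> 1" for w
        proof -
          have "norm w \<le> 2 * r" using that z(1) elim norm_triangle_sub[of w z] by simp
          then show ?thesis using elim(1) by (simp add: B_def R_def power_mult_distrib mult_ac)
        qed
        note d = cauchy_derivative_bounds[OF entire_parts(1) B]
        have "norm (Re (z ^ n)) \<le> R" using abs_Re_le_cmod[of "z ^ n"] z(1) by (simp add: R_def norm_power)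
        then have "1 * exp (- R) * exp (- R) \<le> r * exp (- 1 * r ^ n) * exp (Re (z ^ n))"
          using elim by (intro mult_mono) (auto simp: R_def)
        also have "\<dots> \<le> norm (E z)" using elim(2) z by blast
        finally have lo: "exp (- (2 * R)) \<le> norm (E z)" by (simp flip: exp_add)
        have "4 * norm (A z) * (norm (E z))\<^sup>2 = norm (4 * A z * (E z)\<^sup>2)"
          by (simp add: norm_mult norm_power)
        also have "\<dots> \<le> norm ((deriv E z)\<^sup>2) + norm (2 * E z * deriv (deriv E) z) + norm (1::complex)"
          unfolding A_eq
          using norm_triangle_ineq4[of "(deriv E z)\<^sup>2 - 2 * E z * deriv (deriv E) z" 1]
            norm_triangle_ineq4[of "(deriv E z)\<^sup>2" "2 * E z * deriv (deriv E) z"] by linarith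
        also have "\<dots> \<le> B\<^sup>2 + 2 * B * (2 * B) + B\<^sup>2"
        proof (intro add_mono)
          show "norm ((deriv E z)\<^sup>2) \<le> B\<^sup>2"
            unfolding norm_power by (intro power_mono d) auto
          show "norm (2 * E z * deriv (deriv E) z) \<le> 2 * B * (2 * B)"
            unfolding norm_mult using B1 by (intro mult_mono d B) auto
          show "norm (1::complex) \<le> B\<^sup>2" using B1 by (simp add: one_le_power)
        qed
        also have "\<dots> = 6 * B\<^sup>2" by (simp add: power2_eq_square)
        finally have up: "4 * norm (A z) * (norm (E z))\<^sup>2 \<le> 6 * B\<^sup>2" .
        have "4 * norm (A z) * (exp (- (2 * R)))\<^sup>2 \<le> 4 * norm (A z) * (norm (E z))\<^sup>2"
          using lo by (intro mult_left_mono power_mono) auto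
        then have "4 * norm (A z) * (exp (- (2 * R)))\<^sup>2 * (exp (2 * R))\<^sup>2 \<le> 6 * B\<^sup>2 * (exp (2 * R))\<^sup>2"
          using up by (intro mult_right_mono) auto
        moreover have "(exp (- (2 * R)))\<^sup>2 * (exp (2 * R))\<^sup>2 = 1"
          by (simp add: power_mult_distrib[symmetric] exp_add[symmetric])
        ultimately have "norm (A z) \<le> 3/2 * (B\<^sup>2 * (exp (2 * R))\<^sup>2)"
          by (simp add: mult.assoc)
        also have "\<dots> \<le> exp R * exp R * (B\<^sup>2 * (exp (2 * R))\<^sup>2)"
        proof (intro mult_right_mono)
          have "3 \<le> exp R" using exp_ge_add_one_self[of R] R by linarith
          then have "3 * 1 \<le> exp R * exp R" using R by (intro mult_mono) auto
          then show "3 / 2 \<le> exp R * exp R" by simp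
        qed auto
        also have "\<dots> = exp ((2 * K + 4) * R)"
          by (simp add: B_def K_def power2_eq_square exp_add[symmetric] algebra_simps)
        finally show "norm (A z) \<le> exp ((2 * K + 4) * r ^ n)" by (simp add: R_def)
      qed
    qed
  qed
  show thesis
  proof (rule that)
    from bound obtain r0 where r0: "\<And>r z. r \<ge> r0 \<Longrightarrow> cmod z = r \<Longrightarrow> \<forall>j. norm (z ^ n - \<zeta> j) \<ge> 1 \<Longrightarrow>
      norm (A z) \<le> exp ((2 * K + 4) * r ^ n)"
      unfolding eventually_at_top_linorder by blast
    show "\<forall>\<^sub>F r in at_top. \<forall>z. cmod z \<le> r \<longrightarrow> norm (A z) \<le> exp ((2 * K + 4) * 2 * r ^ n)"
      using eventually_compose_filterlim[OF exists_radius_avoiding_zeros[OF zeta_ge summable_zeta fin count] power_at_top]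
        eventually_ge_at_top[of r0] eventually_gt_at_top[of 0]
    proof eventually_elim
      case (elim r)
      then obtain \<rho> where \<rho>: "r ^ n \<le> \<rho>" "\<rho> \<le> 2 * r ^ n" "\<And>j. \<bar>norm (\<zeta> j) - \<rho>\<bar> \<ge> 1" by blast
      define q where "q = root n \<rho>"
      have rho: "\<rho> > 0" using \<rho>(1) elim by (meson less_le_trans zero_less_power)
      have q: "q ^ n = \<rho>" "q > 0" using n rho by (auto simp: q_def)
      have "r ^ n \<le> q ^ n" using \<rho>(1) q by simp
      then have rq: "r \<le> q" using power_mono_iff[of r q n] n q(2) elim(3) by simp
      show ?case
      proof (intro allI impI)
        fix z assume z: "cmod z \<le> r"
        have "norm (A z) \<le> exp ((2 * K + 4) * q ^ n)"
        proof (rule maximum_modulus_frontier[of A "cball 0 q"])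
          show "A holomorphic_on interior (cball 0 q)" using A by (rule holomorphic_on_subset) auto
          show "continuous_on (closure (cball 0 q)) A"
            using holomorphic_on_imp_continuous_on[OF A] continuous_on_subset by blast
          show "norm (A w) \<le> exp ((2 * K + 4) * q ^ n)" if "w \<in> frontier (cball 0 q)" for w
          proof (rule r0)
            have nw: "norm w = q" using that q(2) by (simp add: frontier_cball)
            then show "norm w = q" .
            show "q \<ge> r0" using elim rq by simp
            show "\<forall>j. norm (w ^ n - \<zeta> j) \<ge> 1"
            proof
              fix j
              have "norm (w ^ n) = \<rho>" using nw q by (simp add: norm_power)
              then show "norm (w ^ n - \<zeta> j) \<ge> 1"
                using norm_triangle_ineq3[of "w ^ n" "\<zeta> j"] \<rho>(3)[of j] by (simp add: abs_minus_commute)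
            qed
          qed
        qed (use z rq in auto)
        also have "\<dots> \<le> exp ((2 * K + 4) * 2 * r ^ n)"
        proof -
          have "(2 * K + 4) * \<rho> \<le> (2 * K + 4) * (2 * r ^ n)"
            using \<rho>(2) by (intro mult_left_mono) (auto simp: K_def)
          then show ?thesis by (simp only: q(1) exp_le_cancel_iff mult.assoc)
        qed
        finally show "norm (A z) \<le> exp ((2 * K + 4) * 2 * r ^ n)" .
      qed
    qed
  qed
qed

text \<open>On the arc where \<open>Re (z\<^sup>n) \<le> - |z|\<^sup>n / 2\<close> the function \<open>E\<close> is exponentially small, while
  \<open>E' / E\<close> and \<open>E'' / E\<close> are at most \<open>exp (R / 16)\<close> up to constants, with \<open>R = r\<^sup>n\<close>. So \<open>- 1 / (4 E\<^sup>2)\<close>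
  dominates \<open>A\<close>. The constant \<open>e\<close> is chosen such that the error terms \<open>e (2 r)\<^sup>n\<close>, \<open>e R\<close> and \<open>e R\<close> in the comparison of
  \<open>|E|\<close> on the unit disc around \<open>z\<close> with \<open>|E z|\<close> add up to \<open>R / 16\<close>.\<close>

lemma growth_order_A: "growth_order A = ereal (real n)"
proof -
  obtain C where C: "\<forall>\<^sub>F r in at_top. \<forall>z. cmod z \<le> r \<longrightarrow> norm (A z) \<le> exp (C * r ^ n)"
    using A_le_exp .
  show ?thesis
  proof (rule growth_order_eqI[OF n A])
    show "\<forall>\<^sub>F r in at_top. \<forall>z. cmod z = r \<longrightarrow> cmod (A z) \<le> exp (C * r ^ n)"
      using C by eventually_elim auto
    define e where "e = 1 / (16 * (2 ^ n + 2) :: real)"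
    have e: "e > 0" by (simp add: e_def add_pos_pos)
    have e': "e * (2 ^ n + 2) = 1/16" by (simp add: e_def add_pos_pos less_imp_neq[symmetric])
    have "e * 2 \<le> e * (2 ^ n + 2)" using e by (intro mult_left_mono) auto
    then have e'': "e \<le> 1/32" using e' by simp
    have "filterlim (\<lambda>r::real. 2 * r) at_top at_top" by real_asymp
    from eventually_compose_filterlim[OF norm_E_le[OF e] this]
    have 1: "\<forall>\<^sub>F r in at_top. \<forall>z. cmod z \<le> 2 * r \<longrightarrow> norm (E z) \<le> 2 * r * exp (e * (2 * r) ^ n) * exp (Re (z ^ n))" .
    \<comment> \<open>This controls the oscillation of \<open>z\<^sup>n\<close> on unit discs.\<close>
    have 2: "\<forall>\<^sub>F r in at_top. real n * (2 * r) ^ (n - 1) \<le> e * r ^ n"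
    proof -
      have "\<forall>\<^sub>F r in at_top. real n * 2 ^ (n - 1) \<le> e * r" using e by real_asymp
      then show ?thesis
        using eventually_ge_at_top[of 0]
      proof eventually_elim
        case (elim r)
        have "real n * (2 * r) ^ (n - 1) = real n * 2 ^ (n - 1) * r ^ (n - 1)" by (simp add: power_mult_distrib)
        also have "\<dots> \<le> e * r * r ^ (n - 1)" using elim by (intro mult_right_mono) auto
        also have "\<dots> = e * r ^ n" using n by (simp add: power_eq_if)
        finally show ?case .
      qed
    qed
    have 3: "\<forall>\<^sub>F R::real in at_top. 4 * exp (1/4 * R) * R\<^sup>2 + 4 * exp (1/8 * R) * R\<^sup>2 + 8 * exp (1/16 * R) * R\<^sup>2 \<le> exp (7/8 * R)"
      by real_asymp
    show "\<forall>\<^sub>F r in at_top. \<forall>t\<in>{2 * pi / (3 * real n)..pi / real n}. exp (1/4 * r ^ n) \<le> cmod (A (of_real r * cis t))"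
      using 1 2 norm_E_ge[OF e] norm_E_le[OF e] eventually_compose_filterlim[OF eventually_ge_at_top[of 4] power_at_top]
        eventually_compose_filterlim[OF 3 power_at_top] eventually_ge_at_top[of 1]
    proof eventually_elim
      case (elim r)
      show ?case
      proof
        fix t assume t: "t \<in> {2 * pi / (3 * real n)..pi / real n}"
        define z where "z = of_real r * cis t"
        define R where "R = r ^ n"
        have "r ^ 1 \<le> r ^ n" using elim n by (intro power_increasing) auto
        then have R: "r \<le> R" "R \<ge> 4" "r \<ge> 1" using elim by (auto simp: R_def)
        have zn: "z ^ n = of_real R * cis (real n * t)"
          by (simp only: z_def R_def power_mult_distrib of_real_power Complex.DeMoivre)
        have "2 * pi / 3 \<le> real n * t" "real n * t \<le> pi" using t n by (auto simp: field_simps)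
        then have "cos (real n * t) \<le> cos (2 * pi / 3)"
          by (intro cos_monotone_0_pi_le) auto
        then have "R * cos (real n * t) \<le> R * (- 1/2)"
          using R by (intro mult_left_mono) (auto simp: cos_120)
        then have Re: "Re (z ^ n) \<le> - (R / 2)" unfolding zn by simp
        have nz: "cmod z = r" "norm (z ^ n) = R" using R elim by (auto simp: z_def R_def norm_mult norm_power)
        have "\<forall>j. norm (z ^ n - \<zeta> j) \<ge> 1"
          using dist_nodes_ge_1[of "z ^ n"] nz Re R by simp
        then have lo: "r * exp (- e * R) * exp (Re (z ^ n)) \<le> norm (E z)" using elim(3) nz R_def by blast
        define x where "x = norm (E z)"
        have x: "x > 0"
          using lo R unfolding x_def by (intro less_le_trans[OF _ lo] mult_pos_pos) auto
        define B where "B = 2 * exp (1/16 * R) * x"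
        have B: "norm (E w) \<le> B" if w: "norm (w - z) \<le> 1" for w
        proof -
          have nw: "norm w \<le> 2 * r" using w nz R norm_triangle_sub[of w z] by simp
          have "norm (w ^ n - z ^ n) \<le> real n * (2 * r) ^ (n - 1) * norm (w - z)"
            using nw nz R by (intro norm_power_diff_le) auto
          also have "\<dots> \<le> real n * (2 * r) ^ (n - 1) * 1" using w R by (intro mult_left_mono) auto
          also have "\<dots> \<le> e * R" using elim(2) by (simp add: R_def)
          finally have "Re (w ^ n) \<le> Re (z ^ n) + e * R"
            using abs_Re_le_cmod[of "w ^ n - z ^ n"] by simp
          then have "2 * r * exp (e * (2 * r) ^ n) * exp (Re (w ^ n)) \<le>
              2 * r * exp (e * (2 * r) ^ n) * exp (Re (z ^ n) + e * R)"
            using R by (intro mult_left_mono) auto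
          also have "\<dots> = 2 * exp (e * (2 ^ n + 2) * R) * (r * exp (- e * R) * exp (Re (z ^ n)))"
          proof -
            have "e * (2 * r) ^ n + (Re (z ^ n) + e * R) = e * (2 ^ n + 2) * R + (- e * R + Re (z ^ n))"
              by (simp add: R_def power_mult_distrib distrib_left distrib_right)
            then have "exp (e * (2 * r) ^ n) * exp (Re (z ^ n) + e * R) =
                exp (e * (2 ^ n + 2) * R) * (exp (- e * R) * exp (Re (z ^ n)))"
              by (simp only: exp_add[symmetric])
            then show ?thesis by (simp only: mult_ac)
          qed
          also have "\<dots> \<le> 2 * exp (e * (2 ^ n + 2) * R) * x"
            using lo by (intro mult_left_mono) (auto simp: x_def)
          also have "\<dots> = B" by (simp only: e' B_def)
          finally show ?thesis using elim(1) nw by fastforce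
        qed
        note d = cauchy_derivative_bounds[OF entire_parts(1) B]
        have x_le: "x \<le> R * exp (- (7/16) * R)"
        proof -
          have "x \<le> r * exp (e * R) * exp (Re (z ^ n))"
            using elim(4) nz by (simp add: x_def R_def)
          also have "\<dots> \<le> R * exp (1/32 * R) * exp (- (R / 2))"
            using R e'' Re by (intro mult_mono) auto
          also have "\<dots> = R * exp (- (15/32) * R)" by (simp flip: exp_add)
          also have "\<dots> \<le> R * exp (- (7/16) * R)" using R by (intro mult_left_mono) auto
          finally show ?thesis .
        qed
        have "1 - norm ((deriv E z)\<^sup>2) - norm (2 * E z * deriv (deriv E) z) \<le> norm (4 * A z * (E z)\<^sup>2)"
          unfolding A_eq
          using norm_triangle_ineq2[of 1 "(deriv E z)\<^sup>2 - 2 * E z * deriv (deriv E) z"]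
            norm_triangle_ineq4[of "(deriv E z)\<^sup>2" "2 * E z * deriv (deriv E) z"]
          by (simp add: norm_minus_commute)
        also have "\<dots> = 4 * norm (A z) * x\<^sup>2"
          by (simp add: norm_mult norm_power x_def)
        finally have a1: "1 - norm ((deriv E z)\<^sup>2) - norm (2 * E z * deriv (deriv E) z) \<le> 4 * norm (A z) * x\<^sup>2" .
        have a2: "norm ((deriv E z)\<^sup>2) \<le> 4 * exp (1/8 * R) * x\<^sup>2"
        proof -
          have "norm ((deriv E z)\<^sup>2) \<le> B\<^sup>2" unfolding norm_power by (intro power_mono d) auto
          also have "\<dots> = 4 * exp (1/8 * R) * x\<^sup>2"
            by (simp add: B_def power2_eq_square exp_add[symmetric] mult_ac)
          finally show ?thesis .
        qed
        have a3: "norm (2 * E z * deriv (deriv E) z) \<le> 8 * exp (1/16 * R) * x\<^sup>2"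
        proof -
          have "norm (2 * E z * deriv (deriv E) z) \<le> 2 * x * (2 * B)"
            unfolding norm_mult using d x by (intro mult_mono) (auto simp: x_def)
          also have "\<dots> = 8 * exp (1/16 * R) * x\<^sup>2" by (simp add: B_def power2_eq_square)
          finally show ?thesis .
        qed
        have x2: "x\<^sup>2 \<le> R\<^sup>2 * exp (- (7/8) * R)"
        proof -
          have "x\<^sup>2 \<le> (R * exp (- (7/16) * R))\<^sup>2" using x_le x by (intro power_mono) auto
          also have "\<dots> = R\<^sup>2 * exp (- (7/8) * R)"
            by (simp add: power2_eq_square exp_add[symmetric])
          finally show ?thesis .
        qed
        have "(4 * exp (1/4 * R) + 4 * exp (1/8 * R) + 8 * exp (1/16 * R)) * x\<^sup>2 \<le>
            (4 * exp (1/4 * R) + 4 * exp (1/8 * R) + 8 * exp (1/16 * R)) * (R\<^sup>2 * exp (- (7/8) * R))"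
          using x2 by (intro mult_left_mono) (auto intro: add_nonneg_nonneg)
        also have "\<dots> \<le> exp (7/8 * R) * exp (- (7/8) * R)"
          using mult_right_mono[OF elim(6), of "exp (- (7/8) * R)"] by (simp add: R_def algebra_simps)
        also have "\<dots> = 1" by (simp flip: exp_add)
        finally have "4 * exp (1/4 * R) * x\<^sup>2 \<le> 4 * norm (A z) * x\<^sup>2"
          using a1 a2 a3 unfolding distrib_right by linarith
        then show "exp (1/4 * r ^ n) \<le> cmod (A (of_real r * cis t))"
          using x by (simp add: R_def z_def)
      qed
    qed
    show "2 * pi / (3 * real n) < pi / real n" "pi / real n \<le> 2 * pi"
      using n by (auto simp: field_simps)
  qed (use n in auto)
qed

end

end

section \<open>Existence for all exponents\<close>

lemma eventually_sum_le_powr: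
  assumes "\<mu>1 \<le> \<mu>2" "e > (0::real)"
    and "\<forall>\<^sub>F R in at_top. f R \<le> R powr (\<mu>1 + e / 2)" "\<forall>\<^sub>F R in at_top. g R \<le> R powr (\<mu>2 + e / 2)"
  shows "\<forall>\<^sub>F R in at_top. f R + g R \<le> R powr (\<mu>2 + e)"
proof -
  have "\<forall>\<^sub>F R in at_top. (2::real) \<le> R powr (e / 2)" using assms(2) by real_asymp
  then show ?thesis
    using assms(3,4) eventually_ge_at_top[of 1]
  proof eventually_elim
    case (elim R)
    have "R powr (\<mu>1 + e / 2) \<le> R powr (\<mu>2 + e / 2)"
      using elim assms(1) by (intro powr_mono) auto
    then have "f R + g R \<le> 2 * R powr (\<mu>2 + e / 2)" using elim by linarith
    also have "\<dots> \<le> R powr (e / 2) * R powr (\<mu>2 + e / 2)"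
      using elim by (intro mult_right_mono) auto
    also have "\<dots> = R powr (\<mu>2 + e)" by (simp add: add.commute flip: powr_add)
    finally show ?case .
  qed
qed

theorem theorem1p4:
  fixes n :: nat and l\<^sub>1 l\<^sub>2 :: real
  assumes "n > 0"
    and "l\<^sub>1 \<in> {0..real n}" and "l\<^sub>2 \<in> {0..real n}"
    and "l\<^sub>1 \<le> l\<^sub>2"
  shows "\<exists>A. entire A \<and> growth_order A = ereal (real n) \<and>
           (\<exists>f\<^sub>1 f\<^sub>2 E. normalized_solutions A f\<^sub>1 f\<^sub>2 \<and>
              E = (\<lambda>z. f\<^sub>1 z * f\<^sub>2 z) \<and> bank_laine E \<and>
              exponent_of_convergence f\<^sub>1 = ereal l\<^sub>1 \<and>
              exponent_of_convergence f\<^sub>2 = ereal l\<^sub>2 \<and>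
              exponent_of_convergence E = ereal l\<^sub>2 \<and>
              ereal l\<^sub>2 \<le> growth_order E \<and>
              growth_order E = ereal (real n))"
proof -
  define \<mu>1 \<mu>2 where "\<mu>1 = l\<^sub>1 / real n" and "\<mu>2 = l\<^sub>2 / real n"
  have mu: "0 \<le> \<mu>1" "\<mu>1 \<le> 1" "0 \<le> \<mu>2" "\<mu>2 \<le> 1" "\<mu>1 \<le> \<mu>2"
    using assms by (auto simp: \<mu>1_def \<mu>2_def divide_right_mono)
  have l: "real n * \<mu>1 = l\<^sub>1" "real n * \<mu>2 = l\<^sub>2"
    using assms(1) by (auto simp: \<mu>1_def \<mu>2_def)
  show ?thesis
  proof (rule exists_bank_laine_nodes[OF assms(1) mu(1-4)])
    fix \<zeta> :: "nat \<Rightarrow> complex" and \<sigma> :: "nat \<Rightarrow> bool"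
    assume z: "inj \<zeta>" "\<And>j. norm (\<zeta> j) \<ge> 2" "\<And>j. \<bar>Re (\<zeta> j)\<bar> \<le> norm (\<zeta> j) / 9"
      "summable (\<lambda>j. norm (1 / \<zeta> j))"
      "\<And>k. exp (\<zeta> k) * genus_zero_product ((\<lambda>j. 1 / \<zeta> j)(k := 0)) (\<zeta> k) =
         (if \<sigma> k then - 1 / of_nat n else 1 / of_nat n)"
      "\<And>R. finite {j. norm (\<zeta> j) \<le> R}"
      "\<forall>\<^sub>F R in at_top. real (card {j. norm (\<zeta> j) \<le> R}) \<le> R / ln R powr (3/2)"
      and upper: "\<And>s e. e > 0 \<Longrightarrow> \<forall>\<^sub>F R in at_top. real (card {j. \<sigma> j = s \<and> norm (\<zeta> j) \<le> R}) \<le> R powr ((if s then \<mu>2 else \<mu>1) + e)"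
      and lower: "\<And>s e. 0 < e \<Longrightarrow> e < (if s then \<mu>2 else \<mu>1) \<Longrightarrow>
          \<forall>\<^sub>F R in at_top. real (card {j. \<sigma> j = s \<and> norm (\<zeta> j) \<le> R}) \<ge> R powr ((if s then \<mu>2 else \<mu>1) - e)"
    interpret bank_laine_nodes n \<zeta> \<sigma>
      by (rule bank_laine_nodes.intro[OF assms(1) z(2-7)])
    obtain A f1 f2 where sol: "A holomorphic_on UNIV" "normalized_solutions A f1 f2" "E = (\<lambda>z. f1 z * f2 z)"
      and zf: "\<And>z. f1 z = 0 \<longleftrightarrow> g1 z = 0" "\<And>z. f2 z = 0 \<longleftrightarrow> g2 z = 0"
      and A: "\<And>z. 4 * A z * (E z)\<^sup>2 = (deriv E z)\<^sup>2 - 2 * E z * deriv (deriv E) z - 1"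
    proof (rule bank_laine_factorization[OF entire_parts(2,3) E_eq])
      show "g1 z = 0 \<Longrightarrow> deriv E z = -1" "g2 z = 0 \<Longrightarrow> deriv E z = 1" for z
        by (fact deriv_E_zeros)+
    next
      fix A f1 f2
      assume "A holomorphic_on UNIV" "normalized_solutions A f1 f2" "E = (\<lambda>z. f1 z * f2 z)"
        "\<And>z. f1 z = 0 \<longleftrightarrow> g1 z = 0" "\<And>z. f2 z = 0 \<longleftrightarrow> g2 z = 0"
        "\<And>z. 4 * A z * (E z)\<^sup>2 = (deriv E z)\<^sup>2 - 2 * E z * deriv (deriv E) z - 1"
      then show thesis by (rule that)
    qed
    have f: "f1 holomorphic_on UNIV" "f2 holomorphic_on UNIV"
      and W: "\<And>z. f1 z * deriv f2 z - deriv f1 z * f2 z = 1"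
      using sol(2) by (auto simp: normalized_solutions_def is_solution_def)
    have E0: "E z = 0 \<longleftrightarrow> g1 z = 0 \<or> g2 z = 0" for z by (simp add: E_eq)
    have bl: "bank_laine E"
      unfolding bank_laine_def using entire_parts(1) E0 deriv_E_zeros by blast
    have e1: "exponent_of_convergence f1 = ereal (real n * \<mu>1)"
    proof (rule exponent_of_convergence_power_zeros[where P = "\<lambda>j. \<not> \<sigma> j" and P' = "\<lambda>j. \<not> \<sigma> j"])
      show "f1 z = 0 \<Longrightarrow> deriv f1 z \<noteq> 0" for z using W[of z] by auto
      show "f1 z = 0 \<Longrightarrow> z = 0 \<or> (\<exists>j. \<not> \<sigma> j \<and> z ^ n = \<zeta> j)" for z using zf g1_eq_0_iff by blast
      show "\<not> \<sigma> j \<Longrightarrow> z ^ n = \<zeta> j \<Longrightarrow> f1 z = 0" for z j using zf g1_eq_0_iff by blast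
    qed (use assms(1) f z mu upper[of _ False] lower[of _ False] in auto)
    have e2: "exponent_of_convergence f2 = ereal (real n * \<mu>2)"
    proof (rule exponent_of_convergence_power_zeros[where P = \<sigma> and P' = \<sigma>])
      show "f2 z = 0 \<Longrightarrow> deriv f2 z \<noteq> 0" for z using W[of z] by auto
      show "f2 z = 0 \<Longrightarrow> z = 0 \<or> (\<exists>j. \<sigma> j \<and> z ^ n = \<zeta> j)" for z using zf g2_eq_0_iff by blast
      show "\<sigma> j \<Longrightarrow> z ^ n = \<zeta> j \<Longrightarrow> f2 z = 0" for z j using zf g2_eq_0_iff by blast
    qed (use assms(1) f z mu upper[of _ True] lower[of _ True] in auto)
    have eE: "exponent_of_convergence E = ereal (real n * \<mu>2)"
    proof (rule exponent_of_convergence_power_zeros[where P = "\<lambda>_. True" and P' = \<sigma>])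
      show "E z = 0 \<Longrightarrow> deriv E z \<noteq> 0" for z using E0 deriv_E_zeros by force
      show "E z = 0 \<Longrightarrow> z = 0 \<or> (\<exists>j. True \<and> z ^ n = \<zeta> j)" for z
        using E0 g1_eq_0_iff g2_eq_0_iff by blast
      show "\<sigma> j \<Longrightarrow> z ^ n = \<zeta> j \<Longrightarrow> E z = 0" for z j using E0 g2_eq_0_iff by blast
      fix e :: real assume e: "e > 0"
      have "card {j. True \<and> norm (\<zeta> j) \<le> R} =
          card {j. \<sigma> j = False \<and> norm (\<zeta> j) \<le> R} + card {j. \<sigma> j = True \<and> norm (\<zeta> j) \<le> R}" for R
        by (subst card_Un_disjoint[symmetric])
          (auto intro!: arg_cong[where f=card] finite_subset[OF _ z(6)[of R]])
      then show "\<forall>\<^sub>F R in at_top. real (card {j. True \<and> norm (\<zeta> j) \<le> R}) \<le> R powr (\<mu>2 + e)"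
        using eventually_sum_le_powr[OF mu(5) e upper[of "e/2" False, simplified] upper[of "e/2" True, simplified]] e
        by simp
    qed (use assms(1) entire_parts z mu lower[of _ True] in auto)
    show ?thesis
      using sol bl e1 e2 eE growth_order_E growth_order_A[OF sol(1) A] assms(3) unfolding l by fastforce
  qed
qed

end
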